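(* Let $(n_k)_{k\ge1}$ be a sequence of positive integers satisfying the Hadamard gap condition $n_{k+1}/n_k\ge q>1$ for all $k\ge1$, and let $\sigma:\mathbb{N}\to\mathbb{N}$ be any permutation. Then $$\limsup_{N\to\infty}\frac{\sum_{k=1}^N\cos(2\pi n_{\sigma(k)}x)}{\sqrt{2N\log\log N}}=\frac1{\sqrt2}$$ for almost every $x\in(0,1)$. *)

theory Defs
  imports "HOL-Analysis.Analysis"
begin

end

theory Submission
  imports Defs "HOL-Probability.Probability" "HOL-Real_Asymp.Real_Asymp"
begin

text \<open>
  Order plays no role for a single exponential moment: sort any finite set of frequencies, cut it
  into long blocks of bounded length separated by short gaps. The spectra of quadratic polynomials in
  the block sums are then so well separated that expectations of products factor exactly, which gives
  the Gaussian exponential moment with variance $1/2$ per term; the frequencies in the gaps are few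
  and are absorbed by a cruder sub-Gaussian bound. Together with dyadic chaining in the permuted order
  this yields the upper half of the law.

  For the lower half, let $A_k$ be the indices of the $k$-th geometric stretch of the permuted sequence
  and let $R_k = \prod_i (1 + \theta_k U_{k,i})$ be the Riesz product over the block sums of $A_k$.
  Since the $A_k$ are disjoint, $E R_k = E R_k R_l = 1$ holds exactly, no matter how the $A_k$
  interleave in frequency, provided that all $k$ use the same cutting into blocks; as there are only
  finitely many phases for the cutting, a good one can be fixed by pigeonhole. Under the density $R_k$
  the partial sum over $A_k$ is close to its extremal size, so truncating $R_k$ and running a second
  moment argument on $\sum_k R_k / k$ shows that almost every point lies in infinitely many of the
  extremal events.
\<close>

text \<open>What blocks the usual route: after a permutation, later terms need not have higher
  frequencies, so the partial sums have no martingale or nearly independent structure in the order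
  of summation. Joint information about two stretches is available only through exact second moments
  of their Riesz products, hence a second moment argument in place of a Borel-Cantelli lemma for
  nearly independent events. The heuristics behind the constants: with n_k terms in A_k, the density
  R_k shifts the mean of the sum over A_k, of variance n_k / 2, to \<theta>_k n_k / 2. For
  \<theta>_k just below 2 sqrt (ln k / n_k) this is just below sqrt (n_k ln k), the scale of the
  law, because ln k is asymptotic to ln ln b^k for stretches ending near b^k. Under its own density,
  ln R_k is concentrated near \<theta>_k^2 n_k / 4, just below ln k. So R_k can be cut off at height
  k with little loss of mass, R_k / k is then at most 1, and the total weight, the sum of 1 / k,
  still diverges.\<close>

section \<open>Trigonometric polynomials with separated spectra\<close>

text \<open>Cosine polynomials with frequencies between \<open>lo\<close> and \<open>hi\<close>.
  Generating them term by term turns closure under sums and products into induction, without Fourier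
  coefficients. The bounds are real so that they can be shifted by another spectrum;
  \<open>lo\<close> may become negative.\<close>

inductive band :: "real \<Rightarrow> real \<Rightarrow> (real \<Rightarrow> real) \<Rightarrow> bool" for lo hi where
  band_zero: "band lo hi (\<lambda>x. 0)"
| band_step: "\<lbrakk>band lo hi g; lo \<le> real m; real m \<le> hi\<rbrakk>
    \<Longrightarrow> band lo hi (\<lambda>x. g x + c * cos (2 * pi * real m * x))"

lemma band_cos: "lo \<le> real m \<Longrightarrow> real m \<le> hi \<Longrightarrow> band lo hi (\<lambda>x. c * cos (2 * pi * real m * x))"
  using band_step[OF band_zero, of lo m hi c] by simp

lemma band_add:
  assumes "band lo hi g" "band lo hi h"
  shows "band lo hi (\<lambda>x. g x + h x)"
  using assms(2)
proof induction
  case band_zero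
  then show ?case using assms(1) by simp
next
  case (band_step h m c)
  from band.band_step[OF band_step.IH band_step.hyps(2,3), of c]
  show ?case by (simp add: add.assoc)
qed

lemma band_cmult: "band lo hi g \<Longrightarrow> band lo hi (\<lambda>x. c * g x)"
proof (induction rule: band.induct)
  case band_zero
  then show ?case using band.band_zero by simp
next
  case (band_step g m d)
  from band.band_step[OF band_step.IH band_step.hyps(2,3), of "c * d"]
  show ?case by (simp add: algebra_simps)
qed

lemma band_sum: "(\<And>i. i \<in> I \<Longrightarrow> band lo hi (g i)) \<Longrightarrow> band lo hi (\<lambda>x. \<Sum>i\<in>I. g i x)"
  by (induction I rule: infinite_finite_induct) (auto intro: band_zero band_add)

lemma band_mono:
  assumes "band lo hi g" "lo' \<le> lo" "hi \<le> hi'"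
  shows "band lo' hi' g"
  using assms by induction (auto intro: band_zero band_step order.trans)

text \<open>A product of cosines has the frequencies k + m and |k - m|. Since k \<le> H, both lie
  within H of m, so the spectrum widens by at most H on each side.\<close>

lemma band_mult_cos:
  assumes "band 0 H g" "lo \<le> real m" "real m \<le> hi"
  shows "band (lo - H) (hi + H) (\<lambda>x. g x * (c * cos (2 * pi * real m * x)))"
  using assms(1)
proof induction
  case band_zero
  then show ?case using band.band_zero by simp
next
  case (band_step g k d)
  \<comment> \<open>\<open>k2\<close> is |k - m|, written by cases because subtraction on nat
    truncates.\<close>
  define k1 k2 where "k1 = k + m" and "k2 = (if k \<le> m then m - k else k - m)"
  have b: "lo - H \<le> real k1" "real k1 \<le> hi + H" "lo - H \<le> real k2" "real k2 \<le> hi + H"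
    using assms band_step.hyps by (auto simp: k1_def k2_def of_nat_diff)
  have eq: "cos (2 * pi * real k * x) * cos (2 * pi * real m * x)
      = (cos (2 * pi * real k1 * x) + cos (2 * pi * real k2 * x)) / 2" for x
  proof -
    have 1: "cos (2 * pi * real k2 * x) = cos (2 * pi * real k * x - 2 * pi * real m * x)"
    proof (cases "k \<le> m")
      case True
      have "cos (2 * pi * real k2 * x) = cos (- (2 * pi * real k * x - 2 * pi * real m * x))"
        using True by (intro arg_cong[of _ _ cos]) (simp add: k2_def of_nat_diff algebra_simps)
      then show ?thesis by (simp only: cos_minus)
    next
      case False
      then show ?thesis by (simp add: k2_def of_nat_diff algebra_simps)
    qed
    have 2: "2 * pi * real k1 * x = 2 * pi * real k * x + 2 * pi * real m * x"
      by (simp add: k1_def algebra_simps)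
    show ?thesis unfolding 1 2 cos_add cos_diff by (simp add: field_simps)
  qed
  have "band (lo - H) (hi + H) (\<lambda>x. g x * (c * cos (2 * pi * real m * x))
     + (d * c / 2) * cos (2 * pi * real k1 * x) + (d * c / 2) * cos (2 * pi * real k2 * x))"
    using b by (intro band.band_step band_step.IH) auto
  moreover have "(g x + d * cos (2 * pi * real k * x)) * (c * cos (2 * pi * real m * x))
     = g x * (c * cos (2 * pi * real m * x))
     + (d * c / 2) * cos (2 * pi * real k1 * x) + (d * c / 2) * cos (2 * pi * real k2 * x)" for x
  proof -
    have "(g x + d * cos (2 * pi * real k * x)) * (c * cos (2 * pi * real m * x))
      = g x * (c * cos (2 * pi * real m * x))
        + d * c * (cos (2 * pi * real k * x) * cos (2 * pi * real m * x))"
      by (simp add: algebra_simps)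
    then show ?thesis unfolding eq by (simp add: field_simps)
  qed
  ultimately show ?case by simp
qed

lemma band_mult:
  assumes "band 0 H g" "band lo hi h"
  shows "band (lo - H) (hi + H) (\<lambda>x. g x * h x)"
  using assms(2)
proof induction
  case band_zero
  then show ?case using band.band_zero by simp
next
  case (band_step h m c)
  show ?case
    using band_add[OF band_step.IH band_mult_cos[OF assms(1) band_step.hyps(2,3), of c]]
    by (simp add: algebra_simps)
qed

lemma band_continuous: "band lo hi g \<Longrightarrow> continuous_on S g"
  by (induction rule: band.induct) (auto intro!: continuous_intros)

section \<open>The unit interval as a probability space, and means of cosine polynomials\<close>

abbreviation unit_M :: "real measure" where
  "unit_M \<equiv> restrict_space lborel {0..1::real}"

global_interpretation unit_M: prob_space unit_M
  by (rule prob_spaceI) (simp add: emeasure_restrict_space space_restrict_space)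

lemma borel_measurable_unit_M:
  "f \<in> borel_measurable borel \<Longrightarrow> f \<in> borel_measurable unit_M"
  by (intro measurable_restrict_space1) simp

lemma integrable_unit_M:
  fixes f :: "real \<Rightarrow> real"
  assumes "continuous_on UNIV f"
  shows "integrable unit_M f"
proof -
  have "compact (f ` {0..1})"
    using assms by (intro compact_continuous_image continuous_on_subset[OF assms]) auto
  then have "bounded (f ` {0..1})"
    by (rule compact_imp_bounded)
  then obtain B where "\<forall>x\<in>{0..1}. \<bar>f x\<bar> \<le> B"
    by (auto simp: bounded_iff)
  then have B: "\<And>x. x \<in> {0..1} \<Longrightarrow> \<bar>f x\<bar> \<le> B"
    by blast
  show ?thesis
    using B by (intro unit_M.integrable_const_bound[of _ B] borel_measurable_unit_M
      borel_measurable_continuous_onI assms AE_I2) (auto simp: space_restrict_space)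
qed

lemma expectation_cos:
  assumes "m > 0"
  shows "unit_M.expectation (\<lambda>x. cos (2 * pi * real m * x)) = 0"
proof -
  let ?F = "\<lambda>x. sin (2 * pi * real m * x) / (2 * pi * real m)"
  have "unit_M.expectation (\<lambda>x. cos (2 * pi * real m * x))
     = (\<integral>x. indicator {0..1} x *\<^sub>R cos (2 * pi * real m * x) \<partial>lborel)"
    by (subst integral_restrict_space) auto
  also have "\<dots> = ?F 1 - ?F 0"
    using assms
    by (intro integral_FTC_Icc continuous_intros)
       (auto intro!: derivative_eq_intros simp: has_real_derivative_iff_has_vector_derivative[symmetric])
  also have "\<dots> = 0"
    using sin_npi2[of "2 * m"] by (simp add: mult_ac sin_int_2pin)
  finally show ?thesis .
qed

lemma expectation_band_0:
  assumes "band lo hi g" "lo > 0"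
  shows "unit_M.expectation g = 0"
  using assms(1)
proof induction
  case (band_step g m c)
  have "m > 0" using band_step.hyps assms by (cases m) auto
  have "unit_M.expectation (\<lambda>x. g x + c * cos (2 * pi * real m * x))
     = unit_M.expectation g + unit_M.expectation (\<lambda>x. c * cos (2 * pi * real m * x))"
    using band_continuous[OF band_step.hyps(1)]
    by (intro Bochner_Integration.integral_add integrable_unit_M continuous_intros)
  then show ?case using expectation_cos[OF \<open>m > 0\<close>] band_step by simp
qed simp

text \<open>Peel off the factor of highest frequency: the earlier product has frequencies up to the
  sum of the earlier \<open>hi\<close>, which is below the next \<open>lo\<close>. Multiplying it by
  the next \<open>h\<close> therefore produces no frequency 0, and only the constant
  \<open>e\<close> reaches the mean. The band of the product is carried along for the
  induction.\<close>

lemma expectation_prod_separated: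
  fixes K :: nat
  assumes band: "\<And>i. i < K \<Longrightarrow> band (lo i) (hi i) (h i)"
    and hi: "\<And>i. i < K \<Longrightarrow> 0 \<le> hi i" and lo: "\<And>i. i < K \<Longrightarrow> (\<Sum>j<i. hi j) < lo i"
  shows "band 0 (\<Sum>i<K. hi i) (\<lambda>x. \<Prod>i<K. e i + h i x)
    \<and> unit_M.expectation (\<lambda>x. \<Prod>i<K. e i + h i x) = (\<Prod>i<K. e i)"
  using assms
proof (induction K)
  case 0
  have "band 0 0 (\<lambda>x. 1)"
    using band_cos[of 0 0 0 1] by simp
  then show ?case using unit_M.prob_space by simp
next
  case (Suc K)
  let ?H = "\<Sum>i<K. hi i" and ?P = "\<lambda>x. \<Prod>i<K. e i + h i x"
  have IH: "band 0 ?H ?P" "unit_M.expectation ?P = (\<Prod>i<K. e i)"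
    using Suc by auto
  have H0: "0 \<le> ?H" using Suc.prems(2) by (intro sum_nonneg) auto
  have lo: "?H < lo K" "0 \<le> hi K" and bK: "band (lo K) (hi K) (h K)" using Suc.prems by auto
  have b: "band (lo K - ?H) (hi K + ?H) (\<lambda>x. ?P x * h K x)"
    by (rule band_mult[OF IH(1) bK])
  have eq: "(\<Prod>i<Suc K. e i + h i x) = e K * ?P x + ?P x * h K x" for x
    by (simp add: algebra_simps)
  have "band 0 (hi K + ?H) (\<lambda>x. e K * ?P x + ?P x * h K x)"
    using lo H0
    by (intro band_add band_cmult band_mono[OF IH(1)] band_mono[OF b]) auto
  moreover have "unit_M.expectation (\<lambda>x. e K * ?P x + ?P x * h K x)
      = e K * unit_M.expectation ?P + unit_M.expectation (\<lambda>x. ?P x * h K x)"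
    by (subst Bochner_Integration.integral_add)
       (auto intro!: integrable_unit_M band_continuous[OF IH(1)] band_continuous[OF b] continuous_intros)
  ultimately show ?case
    unfolding eq using IH(2) expectation_band_0[OF b] lo by (simp add: mult.commute add.commute)
qed

section \<open>Lacunary blocks\<close>

text \<open>
  Blocks that are at least \<open>s\<close> indices apart have separated spectra, even after multiplying two
  block sums: the lowest nonzero frequency of such a product is at least \<open>1 - 1 / q\<close> times the
  lowest frequency of the block.
\<close>

locale lacunary =
  fixes a :: "nat \<Rightarrow> nat" and q :: real and s :: nat
  assumes a_pos: "a k > 0" and q_gt_1: "q > 1"
    and gap: "q * real (a k) \<le> real (a (Suc k))"
    and sep: "5 \<le> (1 - 1 / q) * q ^ s"
begin

text \<open>Indexed by a set rather than a range, so the order of summation disappears: a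
  permutation only decides which sets occur.\<close>

definition T :: "nat set \<Rightarrow> real \<Rightarrow> real" where
  "T A x = (\<Sum>j\<in>A. cos (2 * pi * real (a j) * x))"

text \<open>
  The indices are cut into intervals of length \<open>L\<close> with phase \<open>p\<close>; the first \<open>s\<close> places of each
  interval are the gap, the remaining ones form the block.
\<close>

definition blk :: "nat \<Rightarrow> nat \<Rightarrow> nat set \<Rightarrow> nat \<Rightarrow> nat set" where
  "blk L p A i = {j \<in> A. (j + p) div L = i \<and> s \<le> (j + p) mod L}"

definition big :: "nat \<Rightarrow> nat \<Rightarrow> nat set \<Rightarrow> nat set" where
  "big L p A = {j \<in> A. s \<le> (j + p) mod L}"

lemma gap_power: "q ^ d * real (a k) \<le> real (a (k + d))"
proof (induction d)
  case (Suc d)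
  have "q ^ Suc d * real (a k) = q * (q ^ d * real (a k))" by simp
  also have "\<dots> \<le> q * real (a (k + d))" using Suc q_gt_1 by (intro mult_left_mono) auto
  also have "\<dots> \<le> real (a (k + Suc d))" using gap[of "k + d"] by simp
  finally show ?case .
qed simp

text \<open>Every frequency below \<open>a k\<close> is at most \<open>a k / q\<close>. This keeps
  the difference frequencies in a product of two block sums away from 0.\<close>

lemma gap_diff:
  assumes "j < k"
  shows "(1 - 1 / q) * real (a k) \<le> real (a k) - real (a j)"
proof -
  obtain d where d: "k = Suc (j + d)" using assms less_imp_Suc_add by blast
  have "1 * real (a j) \<le> q ^ d * real (a j)"
    using q_gt_1 by (intro mult_right_mono) auto
  then have "q * real (a j) \<le> q * real (a (j + d))"
    using gap_power[of d j] q_gt_1 by simp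
  also have "\<dots> \<le> real (a k)" using gap[of "j + d"] d by simp
  finally have "real (a j) \<le> real (a k) / q" using q_gt_1 by (simp add: field_simps)
  then show ?thesis by (simp add: algebra_simps)
qed

lemma strict_mono_a: "strict_mono a"
proof (rule strict_monoI)
  fix j k :: nat assume "j < k"
  have "0 < (1 - 1 / q) * real (a k)" using q_gt_1 a_pos[of k] by simp
  then show "a j < a k" using gap_diff[OF \<open>j < k\<close>] by simp
qed

lemma mono_a: "j \<le> k \<Longrightarrow> a j \<le> a k"
  using strict_mono_a by (simp add: strict_mono_less_eq)

lemma s_pos: "s > 0"
proof (rule ccontr)
  assume "\<not> s > 0"
  then have "5 \<le> 1 - 1 / q" using sep by simp
  moreover have "0 < 1 / q" using q_gt_1 by simp
  ultimately show False by linarith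
qed

lemma q_s_ge: "5 \<le> q ^ s"
proof -
  have "(1 - 1 / q) * q ^ s \<le> 1 * q ^ s" using q_gt_1 by (intro mult_right_mono) auto
  then show ?thesis using sep by simp
qed

lemma T_abs_le: "\<bar>T A x\<bar> \<le> real (card A)"
proof -
  have "\<bar>T A x\<bar> \<le> (\<Sum>j\<in>A. \<bar>cos (2 * pi * real (a j) * x)\<bar>)"
    unfolding T_def by (rule sum_abs)
  also have "\<dots> \<le> (\<Sum>j\<in>A. 1)" by (intro sum_mono) auto
  finally show ?thesis by simp
qed

lemma T_continuous: "continuous_on S (T A)"
  unfolding T_def by (intro continuous_intros)

lemma T_union: "finite A \<Longrightarrow> finite B \<Longrightarrow> A \<inter> B = {} \<Longrightarrow> T (A \<union> B) x = T A x + T B x"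
  unfolding T_def by (rule sum.union_disjoint)

lemma band_T:
  assumes "A \<subseteq> {u..v}"
  shows "band (real (a u)) (real (a v)) (T A)"
  unfolding T_def
proof (rule band_sum)
  fix j assume "j \<in> A"
  then show "band (real (a u)) (real (a v)) (\<lambda>x. cos (2 * pi * real (a j) * x))"
    using band_cos[of "real (a u)" "a j" "real (a v)" 1] assms mono_a by auto
qed

text \<open>Of the two resulting frequencies the sum is at most twice the top one, and the
  difference is bounded below by \<open>gap_diff\<close>. On the diagonal the difference is 0 and
  leaves the mean 1 / 2, which is subtracted.\<close>

lemma band_cos_mult_cos:
  assumes "j \<in> {u..v}" "k \<in> {u..v}"
  shows "band ((1 - 1 / q) * real (a u)) (2 * real (a v))
    (\<lambda>x. cos (2 * pi * real (a j) * x) * cos (2 * pi * real (a k) * x) - (if j = k then 1 / 2 else 0))"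
proof -
  have *: "band ((1 - 1 / q) * real (a u)) (2 * real (a v))
    (\<lambda>x. cos (2 * pi * real (a j) * x) * cos (2 * pi * real (a k) * x) - (if j = k then 1 / 2 else 0))"
    if "j \<in> {u..v}" "k \<in> {u..v}" "j \<le> k" for j k
  proof -
    let ?c = "1 - 1 / q" and ?d = "a k - a j"
    have le: "a u \<le> a k" "a k \<le> a v" "a j \<le> a v" "a j \<le> a k" using that mono_a by auto
    have cu: "?c * real (a u) \<le> ?c * real (a k)"
      using q_gt_1 le by (intro mult_left_mono) auto
    have ck: "?c * real (a k) \<le> 1 * real (a k)"
      using q_gt_1 by (intro mult_right_mono) auto
    have d: "real ?d = real (a k) - real (a j)" using le by (simp add: of_nat_diff)
    have b1: "band (?c * real (a u)) (2 * real (a v)) (\<lambda>x. 1 / 2 * cos (2 * pi * real (a j + a k) * x))"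
    proof (rule band_cos)
      show "?c * real (a u) \<le> real (a j + a k)" using cu ck of_nat_0_le_iff[of "a j"] unfolding of_nat_add by linarith
      show "real (a j + a k) \<le> 2 * real (a v)" using le by simp
    qed
    have eq: "cos (2 * pi * real (a j) * x) * cos (2 * pi * real (a k) * x)
       = 1 / 2 * cos (2 * pi * real (a j + a k) * x) + 1 / 2 * cos (2 * pi * real ?d * x)" for x
    proof -
      have "2 * pi * real (a j + a k) * x = 2 * pi * real (a k) * x + 2 * pi * real (a j) * x"
        "2 * pi * real ?d * x = 2 * pi * real (a k) * x - 2 * pi * real (a j) * x"
        by (simp_all add: d algebra_simps)
      then show ?thesis by (simp only: cos_add cos_diff) (simp add: algebra_simps)
    qed
    show ?thesis
    proof (cases "j = k")
      case True
      then show ?thesis using b1 unfolding eq by simp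
    next
      case False
      then have "?c * real (a k) \<le> real ?d" using gap_diff[of j k] that d by simp
      then have "band (?c * real (a u)) (2 * real (a v)) (\<lambda>x. 1 / 2 * cos (2 * pi * real ?d * x))"
      proof (intro band_cos)
        show "?c * real (a u) \<le> real ?d" using cu \<open>?c * real (a k) \<le> real ?d\<close> by linarith
        show "real ?d \<le> 2 * real (a v)" using le by simp
      qed
      from band_add[OF b1 this] show ?thesis unfolding eq using False by simp
    qed
  qed
  show ?thesis
  proof (cases "j \<le> k")
    case False
    then show ?thesis using *[of k j] assms by (simp add: mult.commute eq_commute[of j k])
  next
    case True
    then show ?thesis using *[of j k] assms by blast
  qed
qed

text \<open>Only the diagonal pairs, one for each common index, contribute to the mean; disjoint
  sets are thus orthogonal.\<close>

lemma band_T_mult_T: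
  assumes "A \<subseteq> {u..v}" "B \<subseteq> {u..v}"
  shows "band ((1 - 1 / q) * real (a u)) (2 * real (a v)) (\<lambda>x. T A x * T B x - real (card (A \<inter> B)) / 2)"
proof -
  have fin: "finite A" "finite B" using assms finite_subset by auto
  have "real (card (A \<inter> B)) / 2 = (\<Sum>j\<in>A. \<Sum>k\<in>B. if j = k then 1 / 2 else 0)"
  proof -
    have "(\<Sum>k\<in>B. if j = k then 1 / 2 else 0) = (if j \<in> B then 1 / 2 else (0::real))" for j
      using fin by (simp add: sum.delta')
    then have "(\<Sum>j\<in>A. \<Sum>k\<in>B. if j = k then 1 / 2 else 0) = (\<Sum>j\<in>A. if j \<in> B then 1 / 2 else (0::real))"
      by simp
    also have "\<dots> = (\<Sum>j\<in>A \<inter> B. 1 / 2)"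
      by (rule sum.inter_restrict[symmetric, OF fin(1)])
    finally show ?thesis by simp
  qed
  then have "(\<lambda>x. T A x * T B x - real (card (A \<inter> B)) / 2) = (\<lambda>x. \<Sum>j\<in>A. \<Sum>k\<in>B.
      cos (2 * pi * real (a j) * x) * cos (2 * pi * real (a k) * x) - (if j = k then 1 / 2 else 0))"
    unfolding T_def by (simp add: sum_product sum_subtractf)
  moreover have "band ((1 - 1 / q) * real (a u)) (2 * real (a v)) \<dots>"
    using assms by (intro band_sum band_cos_mult_cos) auto
  ultimately show ?thesis by simp
qed

lemma blk_bounds:
  assumes "p < L" "s < L"
  shows "blk L p A i \<subseteq> {i * L + s - p .. i * L + L - 1 - p}"
proof
  fix j assume "j \<in> blk L p A i"
  then have i: "(j + p) div L = i" and r: "s \<le> (j + p) mod L" by (auto simp: blk_def)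
  have "j + p = i * L + (j + p) mod L" using div_mult_mod_eq[of "j + p" L] i by simp
  moreover have "(j + p) mod L < L" using assms by simp
  ultimately have "i * L + s - p \<le> j" "j \<le> i * L + L - 1 - p" using r by linarith+
  then show "j \<in> {i * L + s - p .. i * L + L - 1 - p}" by simp
qed

text \<open>All exact expectations below are instances: \<open>A = B\<close> gives products of
  quadratic polynomials in one block sum, disjoint \<open>A\<close> and \<open>B\<close> give
  products of two Riesz products. The linear terms have mean 0, so only the bilinear term leaves a
  trace. Both sets are cut by the same \<open>L\<close> and \<open>p\<close>, so that their i-th
  blocks share one frequency window.\<close>

lemma expectation_prod_blocks:
  assumes "p < L" "s < L"
  shows "unit_M.expectation (\<lambda>x. \<Prod>i<K. 1 + \<alpha> * T (blk L p A i) x + \<beta> * T (blk L p B i) x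
      + \<gamma> * (T (blk L p A i) x * T (blk L p B i) x))
    = (\<Prod>i<K. 1 + \<gamma> * real (card (blk L p A i \<inter> blk L p B i)) / 2)"
proof -
  define u v where "u = (\<lambda>i. i * L + s - p)" and "v = (\<lambda>i. i * L + L - 1 - p)"
  let ?c = "1 - 1 / q"
  define lo hi where "lo = (\<lambda>i. ?c * real (a (u i)))" and "hi = (\<lambda>i. 2 * real (a (v i)))"
  \<comment> \<open>\<open>e\<close> is the mean of the i-th factor and \<open>h\<close> its
    mean-free rest.\<close>
  define e where "e = (\<lambda>i. 1 + \<gamma> * real (card (blk L p A i \<inter> blk L p B i)) / 2)"
  define h where "h = (\<lambda>i x. \<alpha> * T (blk L p A i) x + \<beta> * T (blk L p B i) x
      + \<gamma> * (T (blk L p A i) x * T (blk L p B i) x - real (card (blk L p A i \<inter> blk L p B i)) / 2))"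
  have uSuc: "u (Suc i) = v i + s + 1" and vSuc: "u (Suc i) \<le> v (Suc i)" for i
    using assms by (auto simp: u_def v_def)
  have step: "q ^ s * real (a (v i)) \<le> real (a (u (Suc i)))" for i
  proof -
    have "q ^ s * real (a (v i)) \<le> real (a (v i + s))" by (rule gap_power)
    also have "\<dots> \<le> real (a (u (Suc i)))" unfolding uSuc of_nat_le_iff by (intro mono_a) simp
    finally show ?thesis .
  qed
  \<comment> \<open>The top frequencies grow at least by the factor 5, so the sum is dominated by
    its last term. The bound 4 against the 5 in \<open>sep\<close> makes the inequality
    \<open>sum_lo\<close> strict.\<close>
  have sum_hi: "(\<Sum>j<Suc i. hi j) \<le> 4 * real (a (v i))" for i
  proof (induction i)
    case 0
    then show ?case by (simp add: hi_def)
  next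
    case (Suc i)
    have "5 * real (a (v i)) \<le> q ^ s * real (a (v i))" using q_s_ge by (intro mult_right_mono) auto
    also have "\<dots> \<le> real (a (u (Suc i)))" by (rule step)
    also have "\<dots> \<le> real (a (v (Suc i)))" unfolding of_nat_le_iff by (intro mono_a vSuc)
    finally show ?case using Suc by (simp add: hi_def)
  qed
  have sum_lo: "(\<Sum>j<i. hi j) < lo i" for i
  proof (cases i)
    case 0
    then show ?thesis using q_gt_1 a_pos by (simp add: lo_def)
  next
    case (Suc j)
    have "(\<Sum>j<i. hi j) \<le> 4 * real (a (v j))" using sum_hi Suc by blast
    also have "\<dots> < 5 * real (a (v j))" using a_pos by simp
    also have "\<dots> \<le> (?c * q ^ s) * real (a (v j))" using sep by (intro mult_right_mono) auto
    also have "\<dots> \<le> lo i"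
      using mult_left_mono[OF step[of j], of ?c] q_gt_1 Suc by (simp add: lo_def mult.assoc)
    finally show ?thesis .
  qed
  have band: "band (lo i) (hi i) (h i)" for i
  proof -
    have sub: "blk L p A i \<subseteq> {u i..v i}" "blk L p B i \<subseteq> {u i..v i}"
      using blk_bounds[OF assms] unfolding u_def v_def by blast+
    have le: "lo i \<le> real (a (u i))" "real (a (v i)) \<le> hi i"
      using q_gt_1 mult_right_mono[of ?c 1 "real (a (u i))"] by (auto simp: lo_def hi_def)
    show ?thesis unfolding h_def
      by (intro band_add band_cmult band_mono[OF band_T[OF sub(1)]] band_mono[OF band_T[OF sub(2)]]
        band_mono[OF band_T_mult_T[OF sub]]) (use le in \<open>auto simp: lo_def hi_def\<close>)
  qed
  have "unit_M.expectation (\<lambda>x. \<Prod>i<K. e i + h i x) = (\<Prod>i<K. e i)"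
    using expectation_prod_separated[of K lo hi h e] band sum_lo by (simp add: hi_def)
  then show ?thesis by (simp add: e_def h_def algebra_simps)
qed

end

section \<open>Taylor bounds for the factors\<close>

text \<open>The difference of the two sides vanishes at 0, and its derivative has the sign of z. The
  two cases resolve the absolute value.\<close>

lemma ln_one_plus_le_cubic:
  fixes z :: real
  assumes "\<bar>z\<bar> \<le> 1 / 2"
  shows "ln (1 + z) \<le> z - z\<^sup>2 / 2 + \<bar>z\<bar> ^ 3"
proof (cases "0 \<le> z")
  case True
  let ?f = "\<lambda>z::real. z - z\<^sup>2 / 2 + z ^ 3 - ln (1 + z)"
  have "?f 0 \<le> ?f z"
  proof (rule DERIV_nonneg_imp_nondecreasing[OF True])
    fix x :: real assume x: "0 \<le> x" "x \<le> z"
    have "(?f has_real_derivative 1 - x + 3 * x\<^sup>2 - 1 / (1 + x)) (at x)"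
      using x by (auto intro!: derivative_eq_intros)
    moreover have "1 - x + 3 * x\<^sup>2 - 1 / (1 + x) = x\<^sup>2 * (2 + 3 * x) / (1 + x)"
      using x by (simp add: field_simps power2_eq_square power3_eq_cube)
    moreover have "0 \<le> x\<^sup>2 * (2 + 3 * x) / (1 + x)"
      using x by (intro divide_nonneg_nonneg mult_nonneg_nonneg) auto
    ultimately show "\<exists>y. (?f has_real_derivative y) (at x) \<and> 0 \<le> y"
      by auto
  qed
  then show ?thesis using True by simp
next
  case False
  let ?f = "\<lambda>z::real. z - z\<^sup>2 / 2 - z ^ 3 - ln (1 + z)"
  have "?f z \<ge> ?f 0"
  proof (rule DERIV_nonpos_imp_nonincreasing[of z 0])
    show "z \<le> 0" using False by simp
    fix x :: real assume x: "z \<le> x" "x \<le> 0"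
    then have x1: "1 / 2 \<le> 1 + x" using assms by linarith
    have "(?f has_real_derivative 1 - x - 3 * x\<^sup>2 - 1 / (1 + x)) (at x)"
      using x1 by (auto intro!: derivative_eq_intros)
    moreover have "1 - x - 3 * x\<^sup>2 - 1 / (1 + x) = - (x\<^sup>2 * (4 + 3 * x)) / (1 + x)"
      using x1 by (simp add: field_simps power2_eq_square power3_eq_cube)
    moreover have "- (x\<^sup>2 * (4 + 3 * x)) / (1 + x) \<le> 0"
      using x1 by (intro divide_nonpos_nonneg) (auto intro!: mult_nonneg_nonneg)
    ultimately show "\<exists>y. (?f has_real_derivative y) (at x) \<and> y \<le> 0"
      by auto
  qed
  then show ?thesis using False by (simp add: power3_eq_cube)
qed

lemma exp_le_cubic:
  fixes y :: real
  assumes "\<bar>y\<bar> \<le> 1"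
  shows "exp y \<le> 1 + y + y\<^sup>2 / 2 + \<bar>y\<bar> ^ 3"
proof -
  obtain t where t: "\<bar>t\<bar> \<le> \<bar>y\<bar>" "exp y = (\<Sum>m<3. y ^ m / fact m) + exp t / fact 3 * y ^ 3"
    using Maclaurin_exp_le[of y 3] by blast
  have "exp t \<le> exp 1" using t assms by simp
  then have "exp t \<le> 3" using exp_le by linarith
  then have "exp t / fact 3 \<le> 1" by (simp add: fact_numeral)
  have "exp t / fact 3 * y ^ 3 \<le> exp t / fact 3 * \<bar>y\<bar> ^ 3"
    by (intro mult_left_mono) (auto simp: power_abs[symmetric])
  also have "\<dots> \<le> 1 * \<bar>y\<bar> ^ 3" using \<open>exp t / fact 3 \<le> 1\<close> by (intro mult_right_mono) auto
  finally show ?thesis using t(2) by (simp add: numeral_3_eq_3 power2_eq_square)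
qed

text \<open>Only quadratic polynomials in a block sum have exactly computable product expectations,
  so the exponential is replaced by its second-order Taylor polynomial: the logarithm contributes -
  \<kappa> * z^2 / 2 and the square of the linear part (\<kappa> + \<tau>)^2 * z^2 / 2. The error is
  made multiplicative so that it can be pulled out of a product.\<close>

lemma tilted_factor_le:
  fixes z \<kappa> \<tau> :: real
  assumes z: "\<bar>z\<bar> \<le> 1 / 16" and \<kappa>: "0 \<le> \<kappa>" "\<kappa> \<le> 2" and \<tau>: "\<bar>\<tau>\<bar> \<le> 2"
  shows "exp (\<kappa> * ln (1 + z) + \<tau> * z)
    \<le> (1 + (\<kappa> + \<tau>) * z + ((\<kappa> + \<tau>)\<^sup>2 - \<kappa>) / 2 * z\<^sup>2) * exp (400 * \<bar>z\<bar> ^ 3)"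
    and "0 \<le> 1 + (\<kappa> + \<tau>) * z + ((\<kappa> + \<tau>)\<^sup>2 - \<kappa>) / 2 * z\<^sup>2"
proof -
  define \<alpha> r y where "\<alpha> = \<kappa> + \<tau>" and "r = \<kappa> * \<bar>z\<bar> ^ 3 - \<kappa> * z\<^sup>2 / 2" and "y = \<alpha> * z + r"
  define w where "w = \<bar>z\<bar>"
  have w: "0 \<le> w" "w \<le> 1 / 16" "z\<^sup>2 = w\<^sup>2" using z by (auto simp: w_def)
  have w2: "w\<^sup>2 \<le> w / 16" using mult_left_mono[OF w(2) w(1)] by (simp add: power2_eq_square)
  have w3: "w ^ 3 \<le> w\<^sup>2 / 16" "0 \<le> w ^ 3" using mult_left_mono[OF w(2), of "w\<^sup>2"] w(1)
    by (auto simp: power2_eq_square power3_eq_cube)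
  have \<alpha>: "\<bar>\<alpha>\<bar> \<le> 4" using \<kappa> \<tau> by (auto simp: \<alpha>_def)
  have kw: "\<kappa> * w ^ 3 \<le> 2 * w ^ 3" "\<kappa> * w\<^sup>2 \<le> 2 * w\<^sup>2" "0 \<le> \<kappa> * w ^ 3" "0 \<le> \<kappa> * w\<^sup>2"
    using \<kappa> w by (auto intro!: mult_right_mono)
  have r: "\<bar>r\<bar> \<le> w\<^sup>2" using kw w3 unfolding r_def w_def[symmetric] w(3) by linarith
  have az: "\<bar>\<alpha> * z\<bar> \<le> 4 * w" unfolding abs_mult w_def using \<alpha> by (intro mult_right_mono) auto
  have y: "\<bar>y\<bar> \<le> 5 * w" using az r w2 w(1) unfolding y_def by linarith
  have y1: "\<bar>y\<bar> \<le> 1" using y w by linarith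
  have "\<kappa> * ln (1 + z) + \<tau> * z \<le> \<kappa> * (z - z\<^sup>2 / 2 + \<bar>z\<bar> ^ 3) + \<tau> * z"
    using \<kappa> z by (intro add_right_mono mult_left_mono ln_one_plus_le_cubic) auto
  also have "\<dots> = y" by (simp add: y_def \<alpha>_def r_def algebra_simps)
  finally have "exp (\<kappa> * ln (1 + z) + \<tau> * z) \<le> exp y" by simp
  also have "\<dots> \<le> 1 + y + y\<^sup>2 / 2 + \<bar>y\<bar> ^ 3" by (rule exp_le_cubic[OF y1])
  also have "\<bar>y\<bar> ^ 3 \<le> (5 * w) ^ 3" by (intro power_mono y) auto
  also have "(5 * w) ^ 3 = 125 * w ^ 3" by (simp add: power_mult_distrib)
  also have "y\<^sup>2 / 2 = (\<alpha> * z)\<^sup>2 / 2 + \<alpha> * z * r + r\<^sup>2 / 2"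
    by (simp add: y_def power2_eq_square algebra_simps)
  also have "\<alpha> * z * r \<le> (4 * w) * w\<^sup>2"
  proof -
    have "\<alpha> * z * r \<le> \<bar>\<alpha> * z\<bar> * \<bar>r\<bar>" by (simp flip: abs_mult)
    also have "\<dots> \<le> (4 * w) * w\<^sup>2" using az r w by (intro mult_mono) auto
    finally show ?thesis .
  qed
  also have "(4 * w) * w\<^sup>2 = 4 * w ^ 3" by (simp add: power2_eq_square power3_eq_cube)
  also have "r\<^sup>2 / 2 \<le> w ^ 3"
  proof -
    have "r\<^sup>2 \<le> (w\<^sup>2)\<^sup>2" unfolding power2_abs[of r, symmetric] by (intro power_mono r) auto
    also have "\<dots> = w * w ^ 3" by (simp add: power2_eq_square power3_eq_cube)
    also have "\<dots> \<le> 1 * w ^ 3" using w by (intro mult_right_mono) auto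
    finally have "r\<^sup>2 \<le> w ^ 3" by simp
    then show ?thesis using w3(2) by linarith
  qed
  finally have main: "exp (\<kappa> * ln (1 + z) + \<tau> * z)
     \<le> 1 + y + ((\<alpha> * z)\<^sup>2 / 2 + 4 * w ^ 3 + w ^ 3) + 125 * w ^ 3" by simp
  define p where "p = 1 + \<alpha> * z + (\<alpha>\<^sup>2 - \<kappa>) / 2 * z\<^sup>2"
  have "1 + y + (\<alpha> * z)\<^sup>2 / 2 = p + \<kappa> * w ^ 3"
    by (simp add: p_def y_def r_def w_def power2_eq_square field_simps)
  \<comment> \<open>132 = 4 + 1 + 125 + 2, the last summand from \<kappa> \<le> 2.\<close>
  with main have main: "exp (\<kappa> * ln (1 + z) + \<tau> * z) \<le> p + 132 * w ^ 3" using kw by linarith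
  have "0 \<le> \<alpha>\<^sup>2 * w\<^sup>2" by simp
  moreover have "p = 1 + \<alpha> * z + \<alpha>\<^sup>2 * w\<^sup>2 / 2 - \<kappa> * w\<^sup>2 / 2"
    unfolding p_def w(3) by (simp add: algebra_simps diff_divide_distrib)
  ultimately have p: "1 / 2 \<le> p" using az kw w2 w(1,2) by linarith
  \<comment> \<open>As p \<ge> 1 / 2, the additive error 132 * w^3 is absorbed by the factor 1 + 400
    * w^3.\<close>
  have "1 / 2 * (400 * w ^ 3) \<le> p * (400 * w ^ 3)"
    using w3(2) by (intro mult_right_mono p) simp
  then have "p + 132 * w ^ 3 \<le> p * (1 + 400 * w ^ 3)"
    using w3(2) unfolding distrib_left by linarith
  also have "\<dots> \<le> p * exp (400 * w ^ 3)"
    using p by (intro mult_left_mono exp_ge_add_one_self) auto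
  finally have "p + 132 * w ^ 3 \<le> p * exp (400 * w ^ 3)" .
  with main show "exp (\<kappa> * ln (1 + z) + \<tau> * z)
    \<le> (1 + (\<kappa> + \<tau>) * z + ((\<kappa> + \<tau>)\<^sup>2 - \<kappa>) / 2 * z\<^sup>2) * exp (400 * \<bar>z\<bar> ^ 3)"
    unfolding p_def \<alpha>_def w_def by linarith
  show "0 \<le> 1 + (\<kappa> + \<tau>) * z + ((\<kappa> + \<tau>)\<^sup>2 - \<kappa>) / 2 * z\<^sup>2"
    using p unfolding p_def \<alpha>_def by linarith
qed

section \<open>Riesz products\<close>

context lacunary
begin

text \<open>The index set consists of the block numbers met by \<open>A\<close>, so no cutoff
  enters; \<open>R_eq_prod\<close> passes to any sufficiently long range, in particular to a common
  one for two sets, because empty blocks contribute the factor 1.\<close>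

definition R :: "nat \<Rightarrow> nat \<Rightarrow> real \<Rightarrow> nat set \<Rightarrow> real \<Rightarrow> real" where
  "R L p \<theta> A x = (\<Prod>i\<in>(\<lambda>j. (j + p) div L) ` A. 1 + \<theta> * T (blk L p A i) x)"

lemma big_subset: "big L p A \<subseteq> A"
  by (auto simp: big_def)

lemma blk_index_bound:
  fixes A :: "nat set" and p L :: nat
  assumes "finite A"
  obtains K where "\<And>j. j \<in> A \<Longrightarrow> (j + p) div L < K"
proof
  fix j assume "j \<in> A"
  then show "(j + p) div L < Suc (Max ((\<lambda>j. (j + p) div L) ` A))"
    using assms by (intro le_imp_less_Suc Max_ge) auto
qed

lemma R_eq_prod:
  assumes "\<And>j. j \<in> A \<Longrightarrow> (j + p) div L < K"
  shows "R L p \<theta> A x = (\<Prod>i<K. 1 + \<theta> * T (blk L p A i) x)"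
  unfolding R_def
proof (rule prod.mono_neutral_left)
  show "\<forall>i\<in>{..<K} - (\<lambda>j. (j + p) div L) ` A. 1 + \<theta> * T (blk L p A i) x = 1"
  proof
    fix i assume "i \<in> {..<K} - (\<lambda>j. (j + p) div L) ` A"
    then have "blk L p A i = {}" by (auto simp: blk_def)
    then show "1 + \<theta> * T (blk L p A i) x = 1" by (simp add: T_def)
  qed
qed (use assms in auto)

lemma blk_eq: "blk L p A i = {j \<in> big L p A. (j + p) div L = i}"
  by (auto simp: blk_def big_def)

lemma T_big_eq_sum:
  assumes "finite A" "\<And>j. j \<in> A \<Longrightarrow> (j + p) div L < K"
  shows "T (big L p A) x = (\<Sum>i<K. T (blk L p A i) x)"
  unfolding T_def blk_eq
  by (rule sum.group[symmetric]) (use assms in \<open>auto simp: big_def\<close>)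

lemma card_big_eq_sum:
  assumes "finite A" "\<And>j. j \<in> A \<Longrightarrow> (j + p) div L < K"
  shows "card (big L p A) = (\<Sum>i<K. card (blk L p A i))"
  unfolding card_eq_sum blk_eq
  by (rule sum.group[symmetric]) (use assms in \<open>auto simp: big_def\<close>)

lemma card_blk_le:
  assumes "p < L" "s < L"
  shows "card (blk L p A i) \<le> L"
proof -
  have "card (blk L p A i) \<le> card {i * L + s - p .. i * L + L - 1 - p}"
    by (intro card_mono blk_bounds[OF assms]) simp
  also have "\<dots> \<le> L" using assms by (cases i) auto
  finally show ?thesis .
qed

lemma factor_abs_le:
  assumes "p < L" "s < L" "\<bar>\<theta>\<bar> * real L \<le> 1 / 16"
  shows "\<bar>\<theta> * T (blk L p A i) x\<bar> \<le> 1 / 16"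
proof -
  have "\<bar>\<theta> * T (blk L p A i) x\<bar> \<le> \<bar>\<theta>\<bar> * real L"
    unfolding abs_mult using T_abs_le[of "blk L p A i" x] card_blk_le[OF assms(1,2), of A i]
    by (intro mult_left_mono) auto
  then show ?thesis using assms(3) by linarith
qed

lemma R_pos:
  assumes "p < L" "s < L" "\<bar>\<theta>\<bar> * real L \<le> 1 / 16"
  shows "0 < R L p \<theta> A x"
  unfolding R_def
proof (rule prod_pos)
  fix i
  show "0 < 1 + \<theta> * T (blk L p A i) x" using factor_abs_le[OF assms, of A i x] by linarith
qed

lemma R_continuous: "continuous_on S (R L p \<theta> A)"
  unfolding R_def by (intro continuous_intros T_continuous)

lemma expectation_R:
  assumes "p < L" "s < L" "finite A"
  shows "unit_M.expectation (R L p \<theta> A) = 1"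
proof -
  obtain K where K: "\<And>j. j \<in> A \<Longrightarrow> (j + p) div L < K" using blk_index_bound[OF assms(3)] by blast
  have "R L p \<theta> A = (\<lambda>x. \<Prod>i<K. 1 + \<theta> * T (blk L p A i) x)"
    by (rule ext, rule R_eq_prod) (rule K)
  then show ?thesis
    using expectation_prod_blocks[OF assms(1,2), where K = K and \<alpha> = \<theta> and \<beta> = 0 and \<gamma> = 0 and A = A]
    by simp
qed

text \<open>After pairing the factors block by block, the only term with a possible mean is the
  product of the two block sums. Its mean counts common indices, and there are none.\<close>

lemma expectation_R_mult_R:
  assumes "p < L" "s < L" "finite A" "finite B" "A \<inter> B = {}"
  shows "unit_M.expectation (\<lambda>x. R L p \<theta> A x * R L p \<mu> B x) = 1"
proof -
  obtain K where K: "\<And>j. j \<in> A \<union> B \<Longrightarrow> (j + p) div L < K"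
    using blk_index_bound[of "A \<union> B"] assms by blast
  have disj: "blk L p A i \<inter> blk L p B i = {}" for i using assms by (auto simp: blk_def)
  have "R L p \<theta> A x * R L p \<mu> B x = (\<Prod>i<K. 1 + \<theta> * T (blk L p A i) x + \<mu> * T (blk L p B i) x
      + (\<theta> * \<mu>) * (T (blk L p A i) x * T (blk L p B i) x))" for x
  proof -
    have "R L p \<theta> A x * R L p \<mu> B x
        = (\<Prod>i<K. (1 + \<theta> * T (blk L p A i) x) * (1 + \<mu> * T (blk L p B i) x))"
      using K by (simp add: R_eq_prod[where K = K] prod.distrib)
    then show ?thesis by (simp add: algebra_simps)
  qed
  then show ?thesis using expectation_prod_blocks[OF assms(1,2), where K = K] by (simp add: disj)
qed

text \<open>
  With \<open>\<kappa> = 0\<close> this is the moment generating function of the block sums, with \<open>\<kappa> = 1\<close> the one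
  under the density \<open>R\<close>, and with \<open>\<kappa> > 1\<close> it controls the size of \<open>R\<close> under its own density.
\<close>

lemma expectation_tilted_le:
  assumes pL: "p < L" "s < L" and A: "finite A" and \<theta>: "\<bar>\<theta>\<bar> * real L \<le> 1 / 16"
    and \<kappa>: "0 \<le> \<kappa>" "\<kappa> \<le> 2" and \<tau>: "\<bar>\<tau>\<bar> \<le> 2"
  shows "integrable unit_M (\<lambda>x. R L p \<theta> A x powr \<kappa> * exp (\<tau> * (\<theta> * T (big L p A) x)))"
    and "unit_M.expectation (\<lambda>x. R L p \<theta> A x powr \<kappa> * exp (\<tau> * (\<theta> * T (big L p A) x)))
     \<le> exp (((\<kappa> + \<tau>)\<^sup>2 - \<kappa>) / 4 * \<theta>\<^sup>2 * card (big L p A) + 400 * \<bar>\<theta>\<bar> ^ 3 * (real L)\<^sup>2 * card (big L p A))"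
proof -
  obtain K where K: "\<And>j. j \<in> A \<Longrightarrow> (j + p) div L < K" using blk_index_bound[OF A] by blast
  define N where "N = real (card (big L p A))"
  define c where "c = (\<lambda>i. real (card (blk L p A i)))"
  define \<alpha> \<beta> where "\<alpha> = \<kappa> + \<tau>" and "\<beta> = ((\<kappa> + \<tau>)\<^sup>2 - \<kappa>) / 2"
  define z where "z = (\<lambda>i x. \<theta> * T (blk L p A i) x)"
  define E where "E = exp (400 * \<bar>\<theta>\<bar> ^ 3 * (real L)\<^sup>2 * N)"
  have N: "N = (\<Sum>i<K. c i)" using card_big_eq_sum[OF A, of p L K] K by (simp add: N_def c_def)
  have c: "0 \<le> c i" "c i \<le> real L" for i using card_blk_le[OF pL] by (auto simp: c_def)
  have z16: "\<bar>z i x\<bar> \<le> 1 / 16" for i x unfolding z_def by (rule factor_abs_le[OF pL \<theta>])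
  have eq: "R L p \<theta> A x powr \<kappa> * exp (\<tau> * (\<theta> * T (big L p A) x))
      = (\<Prod>i<K. exp (\<kappa> * ln (1 + z i x) + \<tau> * z i x))" for x
  proof -
    have pos: "0 < 1 + z i x" for i using z16[of i x] by linarith
    have R_eq: "R L p \<theta> A x = (\<Prod>i<K. 1 + z i x)"
      unfolding z_def by (rule R_eq_prod) (rule K)
    have "ln (R L p \<theta> A x) = (\<Sum>i<K. ln (1 + z i x))"
      unfolding R_eq using pos by (intro ln_prod) (auto simp: less_imp_neq[symmetric])
    moreover have "\<theta> * T (big L p A) x = (\<Sum>i<K. z i x)"
      using T_big_eq_sum[OF A, of p L K] K by (simp add: z_def sum_distrib_left)
    ultimately show ?thesis using R_pos[OF pL \<theta>, of A x]
      by (simp add: powr_def exp_add[symmetric] exp_sum[symmetric] sum.distrib sum_distrib_left)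
  qed
  have zc: "continuous_on S (z i)" for i S unfolding z_def by (intro continuous_intros T_continuous)
  have z1: "1 + z i x \<noteq> 0" for i x using z16[of i x] by (auto simp: abs_if split: if_splits)
  have int1: "integrable unit_M (\<lambda>x. \<Prod>i<K. exp (\<kappa> * ln (1 + z i x) + \<tau> * z i x))"
    using z1 by (intro integrable_unit_M continuous_intros zc) auto
  then show "integrable unit_M (\<lambda>x. R L p \<theta> A x powr \<kappa> * exp (\<tau> * (\<theta> * T (big L p A) x)))"
    unfolding eq .
  have int2: "integrable unit_M (\<lambda>x. (\<Prod>i<K. 1 + \<alpha> * z i x + \<beta> * (z i x)\<^sup>2) * E)"
    by (intro integrable_unit_M continuous_intros zc)
  have le: "(\<Prod>i<K. exp (\<kappa> * ln (1 + z i x) + \<tau> * z i x))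
      \<le> (\<Prod>i<K. 1 + \<alpha> * z i x + \<beta> * (z i x)\<^sup>2) * E" for x
  proof -
    have "(\<Prod>i<K. exp (\<kappa> * ln (1 + z i x) + \<tau> * z i x))
      \<le> (\<Prod>i<K. (1 + \<alpha> * z i x + \<beta> * (z i x)\<^sup>2) * exp (400 * \<bar>z i x\<bar> ^ 3))"
      unfolding \<alpha>_def \<beta>_def using tilted_factor_le(1)[OF z16 \<kappa> \<tau>] by (intro prod_mono) auto
    also have "\<dots> = (\<Prod>i<K. 1 + \<alpha> * z i x + \<beta> * (z i x)\<^sup>2) * exp (\<Sum>i<K. 400 * \<bar>z i x\<bar> ^ 3)"
      by (simp add: prod.distrib exp_sum)
    also have "\<dots> \<le> (\<Prod>i<K. 1 + \<alpha> * z i x + \<beta> * (z i x)\<^sup>2) * E"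
    proof (rule mult_left_mono)
      show "0 \<le> (\<Prod>i<K. 1 + \<alpha> * z i x + \<beta> * (z i x)\<^sup>2)"
        unfolding \<alpha>_def \<beta>_def using tilted_factor_le(2)[OF z16 \<kappa> \<tau>] by (intro prod_nonneg) auto
      \<comment> \<open>Of the three factors \<open>c i\<close>, two are bounded by L and one is
        kept, so that summing over the blocks gives N instead of the number of blocks.\<close>
      have "400 * \<bar>z i x\<bar> ^ 3 \<le> 400 * \<bar>\<theta>\<bar> ^ 3 * (real L)\<^sup>2 * c i" for i
      proof -
        have "\<bar>z i x\<bar> \<le> \<bar>\<theta>\<bar> * c i"
          unfolding z_def abs_mult c_def by (intro mult_left_mono T_abs_le) auto
        then have "\<bar>z i x\<bar> ^ 3 \<le> (\<bar>\<theta>\<bar> * c i) ^ 3" by (intro power_mono) auto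
        also have "\<dots> = \<bar>\<theta>\<bar> ^ 3 * ((c i)\<^sup>2 * c i)"
          by (simp add: power_mult_distrib power2_eq_square power3_eq_cube)
        also have "\<dots> \<le> \<bar>\<theta>\<bar> ^ 3 * ((real L)\<^sup>2 * c i)"
          using c by (intro mult_left_mono mult_right_mono power_mono) auto
        finally show ?thesis by simp
      qed
      then have "(\<Sum>i<K. 400 * \<bar>z i x\<bar> ^ 3) \<le> (\<Sum>i<K. 400 * \<bar>\<theta>\<bar> ^ 3 * (real L)\<^sup>2 * c i)"
        by (intro sum_mono)
      then show "exp (\<Sum>i<K. 400 * \<bar>z i x\<bar> ^ 3) \<le> E"
        by (simp add: E_def N sum_distrib_left)
    qed
    finally show ?thesis .
  qed
  have "unit_M.expectation (\<lambda>x. R L p \<theta> A x powr \<kappa> * exp (\<tau> * (\<theta> * T (big L p A) x)))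
      \<le> unit_M.expectation (\<lambda>x. (\<Prod>i<K. 1 + \<alpha> * z i x + \<beta> * (z i x)\<^sup>2) * E)"
    unfolding eq by (intro integral_mono int1 int2 le)
  \<comment> \<open>With \<open>B = A\<close> the bilinear term is the square of the block sum,
    whose mean is half the block size.\<close>
  also have "\<dots> = (\<Prod>i<K. 1 + \<beta> * \<theta>\<^sup>2 * c i / 2) * E"
    using expectation_prod_blocks[OF pL, where K = K and \<alpha> = "\<alpha> * \<theta>" and \<beta> = 0
      and \<gamma> = "\<beta> * \<theta>\<^sup>2" and A = A and B = A]
    by (simp add: z_def c_def power2_eq_square mult_ac)
  also have "\<dots> \<le> exp (\<beta> * \<theta>\<^sup>2 * N / 2) * E"
  proof (rule mult_right_mono)
    \<comment> \<open>Comparing factor by factor requires them to be nonnegative. Although \<beta>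
      may be negative, \<kappa> \<le> 2 gives \<beta> \<ge> -1, and \<theta>^2 * c i \<le>
      1.\<close>
    have "(\<Prod>i<K. 1 + \<beta> * \<theta>\<^sup>2 * c i / 2) \<le> (\<Prod>i<K. exp (\<beta> * \<theta>\<^sup>2 * c i / 2))"
    proof (rule prod_mono, intro conjI)
      fix i
      have "0 < real L" using pL by simp
      then have "1 \<le> real L" using pL by simp
      then have "\<theta>\<^sup>2 * c i \<le> \<theta>\<^sup>2 * (real L)\<^sup>2"
        using c[of i] by (intro mult_left_mono) (auto simp: power2_eq_square intro: order.trans[of _ "real L"])
      also have "\<dots> = (\<bar>\<theta>\<bar> * real L)\<^sup>2" by (simp add: power_mult_distrib)
      also have "\<dots> \<le> (1 / 16)\<^sup>2" using \<theta> by (intro power_mono) auto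
      finally have "\<theta>\<^sup>2 * c i \<le> 1" by (simp add: power2_eq_square)
      moreover have "\<kappa> \<le> 2 + (\<kappa> + \<tau>)\<^sup>2" by (intro order.trans[OF \<kappa>(2)]) simp
      then have "- 1 \<le> \<beta>" by (simp add: \<beta>_def)
      moreover have "0 \<le> \<theta>\<^sup>2 * c i" using c by simp
      ultimately have "- 1 \<le> \<beta> * (\<theta>\<^sup>2 * c i)"
        using mult_right_mono[of "- 1" \<beta> "\<theta>\<^sup>2 * c i"] by linarith
      then show "0 \<le> 1 + \<beta> * \<theta>\<^sup>2 * c i / 2" by (simp add: mult.assoc)
    qed (rule exp_ge_add_one_self)
    also have "\<dots> = exp (\<beta> * \<theta>\<^sup>2 * N / 2)"
      by (simp add: exp_sum[symmetric] N sum_distrib_left sum_divide_distrib)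
    finally show "(\<Prod>i<K. 1 + \<beta> * \<theta>\<^sup>2 * c i / 2) \<le> exp (\<beta> * \<theta>\<^sup>2 * N / 2)" .
  qed (simp add: E_def)
  finally show "unit_M.expectation (\<lambda>x. R L p \<theta> A x powr \<kappa> * exp (\<tau> * (\<theta> * T (big L p A) x)))
     \<le> exp (((\<kappa> + \<tau>)\<^sup>2 - \<kappa>) / 4 * \<theta>\<^sup>2 * card (big L p A) + 400 * \<bar>\<theta>\<bar> ^ 3 * (real L)\<^sup>2 * card (big L p A))"
    by (simp add: E_def \<beta>_def N_def exp_add)
qed

end

section \<open>Tail bounds\<close>

lemma unit_M_sets:
  fixes f :: "real \<Rightarrow> real"
  assumes "f \<in> borel_measurable borel"
  shows "{x \<in> space unit_M. t \<le> f x} \<in> sets unit_M"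
  by (rule borel_measurable_le[OF borel_measurable_const borel_measurable_unit_M[OF assms]])

lemma unit_M_expectation_const: "unit_M.expectation (\<lambda>x. c) = (c::real)"
  by (simp only: lebesgue_integral_const unit_M.prob_space) simp

lemma unit_M_chernoff:
  assumes X: "continuous_on UNIV X" and \<theta>: "0 < \<theta>"
    and B: "unit_M.expectation (\<lambda>x. exp (\<theta> * X x)) \<le> B"
  shows "\<P>(x in unit_M. t \<le> X x) \<le> B * exp (- \<theta> * t)"
proof -
  have int: "integrable unit_M (\<lambda>x. exp (\<theta> * X x))"
    by (intro integrable_unit_M continuous_intros X)
  then have "set_integrable unit_M (space unit_M) (\<lambda>x. exp (\<theta> * X x))"
    by (subst set_integrable_def) (rule Bochner_Integration.integrable_cong[THEN iffD2], auto)
  then have "\<P>(x in unit_M. t \<le> X x) \<le> exp (- \<theta> * t) * (\<integral>x\<in>space unit_M. exp (\<theta> * X x) \<partial>unit_M)"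
    by (intro unit_M.Chernoff_ineq_ge \<theta> sets.top)
  also have "\<dots> = exp (- \<theta> * t) * unit_M.expectation (\<lambda>x. exp (\<theta> * X x))"
    using set_integral_space[OF int] by simp
  also have "\<dots> \<le> exp (- \<theta> * t) * B" by (intro mult_left_mono B) auto
  finally show ?thesis by (simp add: mult.commute)
qed

lemma unit_M_chernoff_abs:
  assumes X: "continuous_on UNIV X" and \<theta>: "0 < \<theta>"
    and B: "unit_M.expectation (\<lambda>x. exp (\<theta> * X x)) \<le> B" "unit_M.expectation (\<lambda>x. exp (- \<theta> * X x)) \<le> B"
  shows "\<P>(x in unit_M. t \<le> \<bar>X x\<bar>) \<le> 2 * B * exp (- \<theta> * t)"
proof -
  have mX: "X \<in> borel_measurable borel" "(\<lambda>x. - X x) \<in> borel_measurable borel"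
    using X by (auto intro!: borel_measurable_continuous_onI continuous_intros)
  have "\<P>(x in unit_M. t \<le> \<bar>X x\<bar>)
      \<le> unit_M.prob ({x \<in> space unit_M. t \<le> X x} \<union> {x \<in> space unit_M. t \<le> - X x})"
    using unit_M_sets[OF mX(1)] unit_M_sets[OF mX(2)] by (intro unit_M.finite_measure_mono) auto
  also have "\<dots> \<le> \<P>(x in unit_M. t \<le> X x) + \<P>(x in unit_M. t \<le> - X x)"
    using unit_M_sets[OF mX(1)] unit_M_sets[OF mX(2)] by (intro measure_Un_le)
  also have "\<dots> \<le> B * exp (- \<theta> * t) + B * exp (- \<theta> * t)"
    using B by (intro add_mono unit_M_chernoff X \<theta> continuous_intros) auto
  finally show ?thesis by simp
qed

section \<open>Exponential moments and tails of lacunary sums\<close>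

context lacunary
begin

lemma finite_big: "finite A \<Longrightarrow> finite (big L p A)"
  by (rule finite_subset[OF big_subset])

lemma exp_moment_big:
  assumes "p < L" "s < L" "finite A" "\<bar>\<theta>\<bar> * real L \<le> 1 / 16"
  shows "unit_M.expectation (\<lambda>x. exp (\<theta> * T (big L p A) x))
    \<le> exp (\<theta>\<^sup>2 * card (big L p A) * (1 / 4 + 400 * \<bar>\<theta>\<bar> * (real L)\<^sup>2))"
proof -
  have "R L p \<theta> A x powr 0 = 1" for x using R_pos[OF assms(1,2,4), of A x] by simp
  moreover have "\<bar>\<theta>\<bar> ^ 3 = \<bar>\<theta>\<bar> * \<theta>\<^sup>2" by (simp add: power3_eq_cube power2_eq_square)
  then have "\<theta>\<^sup>2 * N * (1 / 4 + 400 * \<bar>\<theta>\<bar> * (real L)\<^sup>2)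
      = ((0 + 1)\<^sup>2 - 0) / 4 * \<theta>\<^sup>2 * N + 400 * \<bar>\<theta>\<bar> ^ 3 * (real L)\<^sup>2 * N" for N
    by (simp add: distrib_left)
  ultimately show ?thesis
    using expectation_tilted_le(2)[OF assms, of 0 1] by simp
qed

text \<open>Intervals of length \<open>Suc s\<close> leave blocks of at most one index, and the
  bound holds for every \<theta>. For |\<theta>| * L \<le> 1 / 16 the moment bound applies, with 26
  from 400 / 16 = 25 and 1 / 4. For larger \<theta> the trivial bound of |\<theta> * T| is already
  below the quadratic one.\<close>

lemma exp_moment_singletons:
  assumes "p \<le> s" "finite A" "real (card A) \<le> N"
  shows "unit_M.expectation (\<lambda>x. exp (\<theta> * T (big (Suc s) p A) x)) \<le> exp (26 * real (Suc s) * \<theta>\<^sup>2 * N)"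
proof -
  define L B where "L = real (Suc s)" and "B = big (Suc s) p A"
  have L: "1 \<le> L" by (simp add: L_def)
  have "card B \<le> card A" unfolding B_def by (intro card_mono assms big_subset)
  then have B: "real (card B) \<le> N" using assms by simp
  have "unit_M.expectation (\<lambda>x. exp (\<theta> * T B x)) \<le> exp (\<theta>\<^sup>2 * card B * (26 * L))"
  proof (cases "\<bar>\<theta>\<bar> * L \<le> 1 / 16")
    case True
    have "\<bar>\<theta>\<bar> * L\<^sup>2 \<le> 1 / 16 * L"
      using mult_right_mono[OF True, of L] L by (simp add: power2_eq_square mult.assoc)
    then have "1 / 4 + 400 * \<bar>\<theta>\<bar> * L\<^sup>2 \<le> 26 * L" using L by simp
    then have "\<theta>\<^sup>2 * card B * (1 / 4 + 400 * \<bar>\<theta>\<bar> * L\<^sup>2) \<le> \<theta>\<^sup>2 * card B * (26 * L)"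
      by (intro mult_left_mono) auto
    then have "exp (\<theta>\<^sup>2 * card B * (1 / 4 + 400 * \<bar>\<theta>\<bar> * L\<^sup>2)) \<le> exp (\<theta>\<^sup>2 * card B * (26 * L))"
      by simp
    moreover have "unit_M.expectation (\<lambda>x. exp (\<theta> * T B x))
        \<le> exp (\<theta>\<^sup>2 * card B * (1 / 4 + 400 * \<bar>\<theta>\<bar> * L\<^sup>2))"
      unfolding B_def L_def using assms True by (intro exp_moment_big) (auto simp: L_def)
    ultimately show ?thesis by (rule order_trans[rotated])
  next
    case False
    have "exp (\<theta> * T B x) \<le> exp (\<theta>\<^sup>2 * card B * (26 * L))" for x
    proof -
      have "\<theta> * T B x \<le> \<bar>\<theta>\<bar> * \<bar>T B x\<bar>" by (simp flip: abs_mult)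
      also have "\<dots> \<le> \<bar>\<theta>\<bar> * card B" by (intro mult_left_mono T_abs_le) auto
      also have "\<dots> \<le> (\<bar>\<theta>\<bar> * card B) * (\<bar>\<theta>\<bar> * (26 * L))"
        using mult_left_mono[of 1 "\<bar>\<theta>\<bar> * (26 * L)" "\<bar>\<theta>\<bar> * card B"] False by simp
      also have "\<dots> = \<theta>\<^sup>2 * card B * (26 * L)" by (simp add: power2_eq_square)
      finally show ?thesis by simp
    qed
    then have "unit_M.expectation (\<lambda>x. exp (\<theta> * T B x)) \<le> unit_M.expectation (\<lambda>x. exp (\<theta>\<^sup>2 * card B * (26 * L)))"
      by (intro integral_mono integrable_unit_M continuous_intros T_continuous)
    then show ?thesis unfolding unit_M_expectation_const .
  qed
  also have "\<dots> \<le> exp (26 * L * \<theta>\<^sup>2 * N)"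
    using L mult_left_mono[OF B, of "26 * L * \<theta>\<^sup>2"] by (simp add: mult_ac)
  finally show ?thesis by (simp add: L_def B_def)
qed

text \<open>Each j is outside the gap for exactly one of the s + 1 phases, namely p = s - j mod (s +
  1).\<close>

lemma T_eq_sum_phases:
  assumes "finite A"
  shows "T A x = (\<Sum>p\<le>s. T (big (Suc s) p A) x)"
proof -
  have 1: "(\<Sum>p\<le>s. if s \<le> (j + p) mod Suc s then c else 0) = c" for j and c :: real
  proof -
    define r where "r = j mod Suc s"
    have r: "r \<le> s" unfolding r_def using mod_less_divisor[of "Suc s" j] by linarith
    have "s \<le> (j + p) mod Suc s \<longleftrightarrow> p = s - r" if "p \<le> s" for p
    proof -
      have eq: "(j + p) mod Suc s = (r + p) mod Suc s" unfolding r_def by (rule mod_add_left_eq[symmetric])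
      show ?thesis
      proof (cases "r + p \<le> s")
        case True
        then have "(r + p) mod Suc s = r + p" by (intro mod_less) simp
        then show ?thesis unfolding eq using True by linarith
      next
        case False
        then have "(r + p) mod Suc s = (r + p - Suc s) mod Suc s" by (intro le_mod_geq) simp
        also have "\<dots> = r + p - Suc s" using r that by (intro mod_less) linarith
        finally show ?thesis unfolding eq using r that False by linarith
      qed
    qed
    then have "(\<Sum>p\<le>s. if s \<le> (j + p) mod Suc s then c else 0) = (\<Sum>p\<le>s. if p = s - r then c else 0)"
      by (intro sum.cong) auto
    then show ?thesis by simp
  qed
  have "T A x = (\<Sum>j\<in>A. \<Sum>p\<le>s. if s \<le> (j + p) mod Suc s then cos (2 * pi * real (a j) * x) else 0)"
    unfolding T_def 1 ..
  also have "\<dots> = (\<Sum>p\<le>s. \<Sum>j\<in>A. if s \<le> (j + p) mod Suc s then cos (2 * pi * real (a j) * x) else 0)"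
    by (rule sum.swap)
  also have "\<dots> = (\<Sum>p\<le>s. T (big (Suc s) p A) x)"
    unfolding T_def big_def using assms by (intro sum.cong refl sum.inter_filter[symmetric])
  finally show ?thesis .
qed

text \<open>With L = \<open>Suc s\<close>, the Chernoff exponent 26 * L * \<theta>^2 * N - \<theta>
  * t / L has the minimum - t^2 / (104 * L^3 * N). \<open>D\<close> also serves as the prefactor,
  since it exceeds 2 * L.\<close>

definition D :: real where "D = 104 * real (Suc s) ^ 3"

lemma D_ge: "104 \<le> D" "2 * real (Suc s) \<le> D"
proof -
  have "1 \<le> real (Suc s) ^ 3" by (rule one_le_power) simp
  then show "104 \<le> D" by (simp add: D_def)
  have "real (Suc s) ^ 1 \<le> real (Suc s) ^ 3" by (rule power_increasing) auto
  then show "2 * real (Suc s) \<le> D" by (simp add: D_def)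
qed

text \<open>If |T A| reaches t, one of the s + 1 phase sums reaches t / (s + 1). There is no upper
  limit on t, at the price of a poor variance constant; this suffices for sparse leftovers and for
  chaining increments.\<close>

lemma T_tail_crude:
  assumes A: "finite A" "real (card A) \<le> N" and N: "0 < N" and t: "0 < t"
  shows "\<P>(x in unit_M. t \<le> \<bar>T A x\<bar>) \<le> D * exp (- t\<^sup>2 / (D * N))"
proof -
  define L where "L = real (Suc s)"
  define \<theta> where "\<theta> = (t / L) / (52 * L * N)"
  define E where "E = exp (26 * L * \<theta>\<^sup>2 * N)"
  have L: "1 \<le> L" by (simp add: L_def)
  have D_L: "D = 104 * L ^ 3" by (simp add: D_def L_def)
  have \<theta>: "0 < \<theta>" using L N t by (simp add: \<theta>_def)
  have sets: "{x \<in> space unit_M. t / L \<le> \<bar>T B x\<bar>} \<in> sets unit_M" for B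
    by (intro unit_M_sets borel_measurable_continuous_onI continuous_intros T_continuous)
  have one: "\<P>(x in unit_M. t / L \<le> \<bar>T (big (Suc s) p A) x\<bar>) \<le> 2 * E * exp (- \<theta> * (t / L))" if "p \<le> s" for p
    using exp_moment_singletons[OF that A, of \<theta>] exp_moment_singletons[OF that A, of "- \<theta>"]
    by (intro unit_M_chernoff_abs T_continuous \<theta>) (auto simp: E_def L_def)
  have "\<P>(x in unit_M. t \<le> \<bar>T A x\<bar>)
      \<le> unit_M.prob (\<Union>p\<le>s. {x \<in> space unit_M. t / L \<le> \<bar>T (big (Suc s) p A) x\<bar>})"
  proof (rule unit_M.finite_measure_mono)
    show "{x \<in> space unit_M. t \<le> \<bar>T A x\<bar>} \<subseteq> (\<Union>p\<le>s. {x \<in> space unit_M. t / L \<le> \<bar>T (big (Suc s) p A) x\<bar>})"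
    proof (rule subsetI, rule ccontr)
      fix x assume x: "x \<in> {x \<in> space unit_M. t \<le> \<bar>T A x\<bar>}"
        "x \<notin> (\<Union>p\<le>s. {x \<in> space unit_M. t / L \<le> \<bar>T (big (Suc s) p A) x\<bar>})"
      have "\<bar>T A x\<bar> \<le> (\<Sum>p\<le>s. \<bar>T (big (Suc s) p A) x\<bar>)"
        unfolding T_eq_sum_phases[OF A(1)] by (rule sum_abs)
      also have "\<dots> < (\<Sum>p\<le>s. t / L)" using x by (intro sum_strict_mono) (auto simp: not_le)
      also have "\<dots> = t" using L by (simp add: L_def)
      finally show False using x by simp
    qed
    show "(\<Union>p\<le>s. {x \<in> space unit_M. t / L \<le> \<bar>T (big (Suc s) p A) x\<bar>}) \<in> sets unit_M"
      by (rule sets.finite_UN[OF finite_atMost]) (rule sets)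
  qed
  also have "\<dots> \<le> (\<Sum>p\<le>s. \<P>(x in unit_M. t / L \<le> \<bar>T (big (Suc s) p A) x\<bar>))"
  proof (rule unit_M.finite_measure_subadditive_finite)
    show "(\<lambda>p. {x \<in> space unit_M. t / L \<le> \<bar>T (big (Suc s) p A) x\<bar>}) ` {..s} \<subseteq> sets unit_M"
      using sets by blast
  qed simp
  also have "\<dots> \<le> (\<Sum>p\<le>s. 2 * E * exp (- \<theta> * (t / L)))"
    by (intro sum_mono one) simp
  also have "\<dots> = 2 * L * (E * exp (- \<theta> * (t / L)))" unfolding sum_constant L_def by simp
  also have "E * exp (- \<theta> * (t / L)) = exp (- t\<^sup>2 / (D * N))"
  proof -
    have "26 * L * \<theta>\<^sup>2 * N - \<theta> * (t / L) = - t\<^sup>2 / (D * N)"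
    proof -
      have t_eq: "t / L = \<theta> * (52 * L * N)" using L N by (simp add: \<theta>_def)
      have "26 * L * \<theta>\<^sup>2 * N - \<theta> * (t / L) = - (t / L) * \<theta> / 2"
        unfolding t_eq by (simp add: power2_eq_square)
      also have "\<dots> = - t\<^sup>2 / (D * N)"
        by (simp add: \<theta>_def D_L power2_eq_square power3_eq_cube mult_ac)
      finally show ?thesis .
    qed
    moreover have "E * exp (- \<theta> * (t / L)) = exp (26 * L * \<theta>\<^sup>2 * N - \<theta> * (t / L))"
      by (simp add: E_def exp_diff exp_minus divide_inverse)
    ultimately show ?thesis by simp
  qed
  also have "2 * L * exp (- t\<^sup>2 / (D * N)) \<le> D * exp (- t\<^sup>2 / (D * N))"
    using D_ge by (intro mult_right_mono) (auto simp: L_def)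
  finally show ?thesis .
qed

text \<open>Averaging over the phases: each j lies in the gap for at most s of the L phases, so some
  phase loses at most the fraction s / L of \<open>A\<close>.\<close>

lemma exists_phase:
  assumes L: "s < L" and A: "finite A"
  obtains p where "p < L" "real (card (A - big L p A)) \<le> real s / real L * real (card A)"
proof -
  define small where "small = (\<lambda>p. {j \<in> A. (j + p) mod L < s})"
  have fin: "finite (small p)" for p using A by (simp add: small_def)
  have cnt: "card {p \<in> {..<L}. (j + p) mod L < s} \<le> s" for j
  proof -
    have "inj_on (\<lambda>p. (j + p) mod L) {p \<in> {..<L}. (j + p) mod L < s}"
    proof (rule inj_onI)
      have *: "p = p'" if "p \<le> p'" "p' < L" "(j + p) mod L = (j + p') mod L" for p p'
      proof -
        have "L dvd (j + p') - (j + p)"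
          using that mod_eq_dvd_iff_nat[of "j + p" "j + p'" L] by simp
        then have "L dvd p' - p" by simp
        then show ?thesis using that nat_dvd_not_less[of "p' - p" L] by (cases "p' - p = 0") auto
      qed
      fix p p' assume "p \<in> {p \<in> {..<L}. (j + p) mod L < s}" "p' \<in> {p \<in> {..<L}. (j + p) mod L < s}"
        "(j + p) mod L = (j + p') mod L"
      then show "p = p'" using *[of p p'] *[of p' p] by (cases "p \<le> p'") auto
    qed
    then have "card {p \<in> {..<L}. (j + p) mod L < s} \<le> card {..<s}"
      by (rule card_inj_on_le) auto
    then show ?thesis by simp
  qed
  have "(\<Sum>p<L. card (small p)) = (\<Sum>p<L. \<Sum>j\<in>A. if (j + p) mod L < s then 1 else 0)"
    unfolding small_def card_eq_sum using A by (intro sum.cong refl sum.inter_filter)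
  also have "\<dots> = (\<Sum>j\<in>A. \<Sum>p<L. if (j + p) mod L < s then 1 else 0)" by (rule sum.swap)
  also have "\<dots> = (\<Sum>j\<in>A. card {p \<in> {..<L}. (j + p) mod L < s})"
    unfolding card_eq_sum by (intro sum.cong refl sum.inter_filter[symmetric]) simp
  also have "\<dots> \<le> (\<Sum>j\<in>A. s)" by (intro sum_mono cnt)
  finally have le: "(\<Sum>p<L. card (small p)) \<le> s * card A" by (simp add: mult.commute)
  have "\<exists>p<L. L * card (small p) \<le> s * card A"
  proof (rule ccontr)
    assume "\<not> (\<exists>p<L. L * card (small p) \<le> s * card A)"
    then have "(\<Sum>p<L. s * card A) < (\<Sum>p<L. L * card (small p))"
      using L by (intro sum_strict_mono) (auto simp: not_le)
    then have "L * (s * card A) < L * (\<Sum>p<L. card (small p))" by (simp add: sum_distrib_left)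
    then show False using le by simp
  qed
  then obtain p where p: "p < L" "L * card (small p) \<le> s * card A" by blast
  have "A - big L p A = small p" by (auto simp: big_def small_def)
  moreover have "real L * real (card (small p)) \<le> real s * real (card A)"
    using p(2) unfolding of_nat_mult[symmetric] of_nat_le_iff .
  ultimately show ?thesis using that[of p] p(1) L by (simp add: field_simps)
qed

text \<open>The lowered threshold costs two factors 1 - \<epsilon>, the cubic error of the
  exponential moment a third, and (1 - \<epsilon>)^3 \<ge> 1 - 3 * \<epsilon>. The assumption
  \<open>small\<close> bounds that error by \<epsilon> / 4; 3200 = 4 * 2 * 400.\<close>

lemma T_tail_big:
  assumes "p < L" "s < L" and A: "finite A" "real (card A) \<le> N" and N: "0 < N" and t: "0 < t"
    and \<epsilon>: "0 < \<epsilon>" "\<epsilon> < 1" and small: "3200 * (real L)\<^sup>2 * t \<le> \<epsilon> * N"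
  shows "\<P>(x in unit_M. (1 - \<epsilon>) * t \<le> \<bar>T (big L p A) x\<bar>) \<le> 2 * exp (- (1 - 3 * \<epsilon>) * t\<^sup>2 / N)"
proof -
  define B where "B = big L p A"
  \<comment> \<open>The minimiser of \<theta>^2 * N / 4 - \<theta> * (1 - \<epsilon>) * t.\<close>
  define \<theta> where "\<theta> = 2 * (1 - \<epsilon>) * t / N"
  define E where "E = \<theta>\<^sup>2 * N * (1 / 4 + 400 * \<theta> * (real L)\<^sup>2)"
  have \<theta>: "0 < \<theta>" using \<epsilon> t N by (simp add: \<theta>_def)
  have tN: "3200 * (real L)\<^sup>2 * (t / N) \<le> \<epsilon>" using small N by (simp add: field_simps)
  have \<theta>_eq: "\<theta> = 2 * ((1 - \<epsilon>) * (t / N))" by (simp add: \<theta>_def)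
  have "(1 - \<epsilon>) * (t / N) \<le> 1 * (t / N)" using \<epsilon> t N by (intro mult_right_mono) auto
  then have \<theta>_le: "\<theta> \<le> 2 * (t / N)" using \<theta>_eq by linarith
  have "1 \<le> real L" using assms by simp
  then have L2: "real L \<le> (real L)\<^sup>2" by (simp add: power2_eq_square)
  have "400 * \<theta> * (real L)\<^sup>2 \<le> 400 * (2 * (t / N)) * (real L)\<^sup>2"
    using \<theta>_le by (intro mult_right_mono mult_left_mono) auto
  also have "\<dots> = (3200 * (real L)\<^sup>2 * (t / N)) / 4" by simp
  also have "\<dots> \<le> \<epsilon> / 4" using tN by (rule divide_right_mono) simp
  finally have err: "400 * \<theta> * (real L)\<^sup>2 \<le> \<epsilon> / 4" .
  have "\<theta> * real L \<le> \<theta> * (real L)\<^sup>2" using L2 \<theta> by (intro mult_left_mono) auto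
  then have "\<theta> * real L \<le> 1 / 16" using err \<epsilon> by linarith
  then have \<theta>L: "\<bar>\<theta>\<bar> * real L \<le> 1 / 16" "\<bar>- \<theta>\<bar> * real L \<le> 1 / 16" using \<theta> by auto
  have "card B \<le> card A" unfolding B_def by (intro card_mono A big_subset)
  then have B: "real (card B) \<le> N" using A by simp
  have le: "unit_M.expectation (\<lambda>x. exp (\<theta>' * T B x)) \<le> exp E"
    if "\<bar>\<theta>'\<bar> = \<theta>" for \<theta>'
  proof -
    have "\<theta>'\<^sup>2 = \<theta>\<^sup>2" using that by (metis power2_abs)
    then have "unit_M.expectation (\<lambda>x. exp (\<theta>' * T B x))
      \<le> exp (\<theta>\<^sup>2 * card B * (1 / 4 + 400 * \<theta> * (real L)\<^sup>2))"
      using exp_moment_big[OF assms(1,2) A(1), of \<theta>'] \<theta>L that \<theta> by (simp add: B_def)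
    also have "\<dots> \<le> exp E"
      unfolding E_def exp_le_cancel_iff using B \<theta> by (intro mult_right_mono mult_left_mono) auto
    finally show ?thesis .
  qed
  have "\<P>(x in unit_M. (1 - \<epsilon>) * t \<le> \<bar>T B x\<bar>) \<le> 2 * exp E * exp (- \<theta> * ((1 - \<epsilon>) * t))"
    using le[of \<theta>] le[of "- \<theta>"] \<theta> by (intro unit_M_chernoff_abs T_continuous) auto
  also have "\<dots> = 2 * exp (E - \<theta> * ((1 - \<epsilon>) * t))"
    by (simp add: exp_diff exp_minus divide_inverse)
  also have "E - \<theta> * ((1 - \<epsilon>) * t) \<le> - (1 - 3 * \<epsilon>) * t\<^sup>2 / N"
  proof -
    define w where "w = (1 - \<epsilon>)\<^sup>2 * t\<^sup>2 / N"
    have "E \<le> \<theta>\<^sup>2 * N * (1 / 4 + \<epsilon> / 4)"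
      unfolding E_def using err N by (intro mult_left_mono) auto
    also have "\<theta>\<^sup>2 * N = 4 * w"
      using N by (simp add: \<theta>_def w_def power_mult_distrib power_divide power2_eq_square)
        (simp add: algebra_simps)
    finally have "E \<le> w * (1 + \<epsilon>)" by (simp add: algebra_simps)
    moreover have "\<theta> * ((1 - \<epsilon>) * t) = 2 * w" by (simp add: \<theta>_eq w_def power2_eq_square)
    ultimately have "E - \<theta> * ((1 - \<epsilon>) * t) \<le> - (1 - \<epsilon>) * w" by (simp add: algebra_simps)
    also have "\<dots> = - ((1 - \<epsilon>) * (1 - \<epsilon>)\<^sup>2) * (t\<^sup>2 / N)"
    proof -
      have "- c * (d * e / N) = - (c * d) * (e / N)" for c d e :: real by simp
      then show ?thesis unfolding w_def .
    qed
    also have "\<dots> \<le> - (1 - 3 * \<epsilon>) * (t\<^sup>2 / N)"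
    proof (rule mult_right_mono)
      have "(1 - \<epsilon>) * (1 - \<epsilon>)\<^sup>2 = 1 - 3 * \<epsilon> + \<epsilon>\<^sup>2 * (3 - \<epsilon>)"
        by (simp add: power2_eq_square algebra_simps)
      then show "- ((1 - \<epsilon>) * (1 - \<epsilon>)\<^sup>2) \<le> - (1 - 3 * \<epsilon>)" using \<epsilon> by simp
    qed (use N in simp)
    finally show ?thesis by simp
  qed
  then have "2 * exp (E - \<theta> * ((1 - \<epsilon>) * t)) \<le> 2 * exp (- (1 - 3 * \<epsilon>) * t\<^sup>2 / N)" by simp
  finally show ?thesis by (simp add: B_def)
qed

text \<open>The exponent t^2 / N is the Gaussian t^2 / (2 * V) with V = N / 2. The threshold is
  shared out: (1 - \<epsilon>) * t for the long blocks, \<epsilon> * t for the gaps.\<close>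

lemma T_tail_sharp:
  assumes \<eta>: "0 < \<eta>" "\<eta> < 1"
  obtains \<delta> K where "0 < \<delta>" "0 < K"
    "\<And>A N t. finite A \<Longrightarrow> real (card A) \<le> N \<Longrightarrow> 0 < N \<Longrightarrow> 0 < t \<Longrightarrow> t \<le> \<delta> * N \<Longrightarrow>
       \<P>(x in unit_M. t \<le> \<bar>T A x\<bar>) \<le> K * exp (- (1 - \<eta>) * t\<^sup>2 / N)"
proof -
  define \<epsilon> where "\<epsilon> = \<eta> / 3"
  have \<epsilon>: "0 < \<epsilon>" "\<epsilon> < 1" using \<eta> by (auto simp: \<epsilon>_def)
  \<comment> \<open>L makes the gaps so sparse, at most N' = s * N / L indices, that D * N' \<le>
    \<epsilon>^2 * N. Then even the crude bound at \<epsilon> * t is as small as the sharp one at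
    t.\<close>
  define L where "L = nat \<lceil>D * real s / \<epsilon>\<^sup>2\<rceil> + s + 1"
  have L: "s < L" "D * real s / \<epsilon>\<^sup>2 \<le> real L" unfolding L_def by linarith+
  have D0: "0 < D" using D_ge by linarith
  define \<delta> where "\<delta> = \<epsilon> / (3200 * (real L)\<^sup>2)"
  have L0: "0 < real L" using L by simp
  have main: "\<P>(x in unit_M. t \<le> \<bar>T A x\<bar>) \<le> (2 + D) * exp (- (1 - \<eta>) * t\<^sup>2 / N)"
    if A: "finite A" "real (card A) \<le> N" and N: "0 < N" and t: "0 < t" "t \<le> \<delta> * N" for A N t
  proof -
    obtain p where p: "p < L" "real (card (A - big L p A)) \<le> real s / real L * real (card A)"
      using exists_phase[OF L(1) A(1)] by blast
    define B where "B = big L p A"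
    define N' where "N' = real s / real L * N"
    have N': "0 < N'" using s_pos L0 N by (simp add: N'_def)
    have cB: "real (card (A - B)) \<le> N'"
      using p(2) mult_left_mono[OF A(2), of "real s / real L"] by (simp add: B_def N'_def)
    have sets: "{x \<in> space unit_M. c \<le> \<bar>T C x\<bar>} \<in> sets unit_M" for c C
      by (intro unit_M_sets borel_measurable_continuous_onI continuous_intros T_continuous)
    have split: "T A x = T B x + T (A - B) x" for x
    proof -
      have "A = B \<union> (A - B)" unfolding B_def using big_subset by blast
      then show ?thesis using T_union[of B "A - B" x] A(1) finite_big[OF A(1), of L p]
        by (simp add: B_def)
    qed
    have "\<P>(x in unit_M. t \<le> \<bar>T A x\<bar>)
       \<le> unit_M.prob ({x \<in> space unit_M. (1 - \<epsilon>) * t \<le> \<bar>T B x\<bar>} \<union> {x \<in> space unit_M. \<epsilon> * t \<le> \<bar>T (A - B) x\<bar>})"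
    proof (rule unit_M.finite_measure_mono)
      show "{x \<in> space unit_M. t \<le> \<bar>T A x\<bar>}
        \<subseteq> {x \<in> space unit_M. (1 - \<epsilon>) * t \<le> \<bar>T B x\<bar>} \<union> {x \<in> space unit_M. \<epsilon> * t \<le> \<bar>T (A - B) x\<bar>}"
        unfolding split by (auto simp: algebra_simps)
    qed (intro sets.Un sets)
    also have "\<dots> \<le> \<P>(x in unit_M. (1 - \<epsilon>) * t \<le> \<bar>T B x\<bar>) + \<P>(x in unit_M. \<epsilon> * t \<le> \<bar>T (A - B) x\<bar>)"
      by (intro measure_Un_le sets)
    also have "\<P>(x in unit_M. (1 - \<epsilon>) * t \<le> \<bar>T B x\<bar>) \<le> 2 * exp (- (1 - 3 * \<epsilon>) * t\<^sup>2 / N)"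
      unfolding B_def
    proof (rule T_tail_big[OF p(1) L(1) A N t(1) \<epsilon>])
      have "3200 * (real L)\<^sup>2 * t \<le> 3200 * (real L)\<^sup>2 * (\<delta> * N)"
        using t by (intro mult_left_mono) auto
      also have "\<dots> = \<epsilon> * N" using L0 by (simp add: \<delta>_def)
      finally show "3200 * (real L)\<^sup>2 * t \<le> \<epsilon> * N" .
    qed
    also have "\<P>(x in unit_M. \<epsilon> * t \<le> \<bar>T (A - B) x\<bar>) \<le> D * exp (- (\<epsilon> * t)\<^sup>2 / (D * N'))"
      using A cB N' \<epsilon> t by (intro T_tail_crude) auto
    also have "D * exp (- (\<epsilon> * t)\<^sup>2 / (D * N')) \<le> D * exp (- (1 - 3 * \<epsilon>) * t\<^sup>2 / N)"
    proof -
      have "D * real s \<le> real L * \<epsilon>\<^sup>2" using L(2) \<epsilon> by (simp add: divide_le_eq)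
      then have "D * N' \<le> \<epsilon>\<^sup>2 * N"
        using L0 N mult_right_mono[of "D * real s" "real L * \<epsilon>\<^sup>2" "N / real L"] by (simp add: N'_def mult_ac)
      then have "t\<^sup>2 / N \<le> (\<epsilon> * t)\<^sup>2 / (D * N')"
        using N N' D0 mult_left_mono[of "D * N'" "\<epsilon>\<^sup>2 * N" "t\<^sup>2"]
        by (simp add: divide_simps power_mult_distrib mult_ac)
      moreover have "(1 - 3 * \<epsilon>) * (t\<^sup>2 / N) \<le> 1 * (t\<^sup>2 / N)"
        using \<epsilon> N by (intro mult_right_mono) auto
      ultimately have "(1 - 3 * \<epsilon>) * (t\<^sup>2 / N) \<le> (\<epsilon> * t)\<^sup>2 / (D * N')" by linarith
      then have "- (\<epsilon> * t)\<^sup>2 / (D * N') \<le> - (1 - 3 * \<epsilon>) * t\<^sup>2 / N"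
        unfolding minus_mult_left[symmetric] minus_divide_left[symmetric] by simp
      then show ?thesis using D0 by (intro mult_left_mono) auto
    qed
    finally show ?thesis by (simp add: \<epsilon>_def distrib_right)
  qed
  have "0 < \<delta>" using \<epsilon> L0 by (simp add: \<delta>_def)
  with main D0 show ?thesis using that[of \<delta> "2 + D"] by simp
qed

end

section \<open>Chaining\<close>

text \<open>The binary digits of j describe a path from b to b + j with at most one dyadic step of
  each length 2^e. The induction decides the top digit.\<close>

lemma dyadic_chaining:
  fixes g :: "nat \<Rightarrow> real"
  assumes "\<And>e i. e < m \<Longrightarrow> Suc i * 2 ^ e \<le> 2 ^ m \<Longrightarrow> \<bar>g (b + Suc i * 2 ^ e) - g (b + i * 2 ^ e)\<bar> \<le> \<tau> e"
    and "j < 2 ^ m"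
  shows "\<bar>g (b + j) - g b\<bar> \<le> (\<Sum>e<m. \<tau> e)"
  using assms
proof (induction m arbitrary: b j)
  case 0
  then show ?case by simp
next
  case (Suc m)
  have lvl: "\<bar>g (b + Suc i * 2 ^ e) - g (b + i * 2 ^ e)\<bar> \<le> \<tau> e" if "e < m" "Suc i * 2 ^ e \<le> 2 ^ m" for e i
    using that by (intro Suc.prems(1)) (auto intro: order.trans)
  have top: "\<bar>g (b + 2 ^ m) - g b\<bar> \<le> \<tau> m" using Suc.prems(1)[of m 0] by simp
  show ?case
  proof (cases "j < 2 ^ m")
    case True
    then have "\<bar>g (b + j) - g b\<bar> \<le> (\<Sum>e<m. \<tau> e)" by (intro Suc.IH lvl)
    then show ?thesis using top by (simp add: order.trans[OF abs_ge_zero])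
  next
    case False
    define j' where "j' = j - 2 ^ m"
    have j': "j' < 2 ^ m" "b + j = (b + 2 ^ m) + j'" using False Suc.prems(2) by (auto simp: j'_def)
    have "\<bar>g ((b + 2 ^ m) + j') - g (b + 2 ^ m)\<bar> \<le> (\<Sum>e<m. \<tau> e)"
    proof (rule Suc.IH[OF _ j'(1)])
      fix e i :: nat assume e: "e < m" "Suc i * 2 ^ e \<le> 2 ^ m"
      have p: "(2::nat) ^ m = 2 ^ (m - e) * 2 ^ e" using e by (simp add: power_add[symmetric])
      have "Suc (2 ^ (m - e) + i) * 2 ^ e = 2 ^ m + Suc i * 2 ^ e"
        unfolding p by (simp add: algebra_simps)
      moreover have "(2 ^ (m - e) + i) * 2 ^ e = 2 ^ m + i * 2 ^ e"
        unfolding p by (simp add: algebra_simps)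
      ultimately show "\<bar>g (b + 2 ^ m + Suc i * 2 ^ e) - g (b + 2 ^ m + i * 2 ^ e)\<bar> \<le> \<tau> e"
        using Suc.prems(1)[of e "2 ^ (m - e) + i"] e by (simp add: add_ac)
    qed
    then show ?thesis unfolding j'(2) using top by simp
  qed
qed

lemma sum_power_diff_le:
  fixes c :: real
  assumes "0 \<le> c" "c < 1"
  shows "(\<Sum>e<m. c ^ (m - e)) \<le> c / (1 - c)"
proof (induction m)
  case 0
  then show ?case using assms by simp
next
  case (Suc m)
  have "(\<Sum>e<Suc m. c ^ (Suc m - e)) = c * (\<Sum>e<m. c ^ (m - e)) + c"
    by (simp add: sum_distrib_left Suc_diff_le)
  also have "\<dots> \<le> c * (c / (1 - c)) + c" using Suc assms by (intro add_right_mono mult_left_mono)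
  also have "\<dots> = c / (1 - c)" using assms by (simp add: field_simps)
  finally show ?case .
qed

section \<open>A maximal inequality in the permuted order\<close>

context lacunary
begin

lemma T_abs_sets: "{x \<in> space unit_M. c \<le> \<bar>T C x\<bar>} \<in> sets unit_M"
  by (intro unit_M_sets borel_measurable_continuous_onI continuous_intros T_continuous)

lemma T_image_diff:
  fixes i j :: nat
  assumes "inj \<rho>" "i \<le> j"
  shows "T (\<rho> ` {..<j}) x - T (\<rho> ` {..<i}) x = T (\<rho> ` {i..<j}) x"
proof -
  have "{..<j} = {..<i} \<union> {i..<j}" using assms by auto
  then have "T (\<rho> ` {..<j}) x = T (\<rho> ` {..<i} \<union> \<rho> ` {i..<j}) x" by (simp add: image_Un)
  also have "\<dots> = T (\<rho> ` {..<i}) x + T (\<rho> ` {i..<j}) x"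
    using assms by (intro T_union) (auto simp: inj_eq)
  finally show ?thesis by simp
qed

lemma T_maximal:
  fixes \<rho> :: "nat \<Rightarrow> nat"
  assumes \<rho>: "inj \<rho>" and t: "0 < t" and y: "y = t\<^sup>2 / (16 * D * 2 ^ m)" "16 \<le> y"
  shows "\<P>(x in unit_M. \<exists>j<2 ^ m. t \<le> \<bar>T (\<rho> ` {b..<b + j}) x\<bar>) \<le> D * exp (- y)"
proof -
  \<comment> \<open>The ratio 3 / 4 makes the thresholds sum to at most 3 * t / 4, yet its square 9
    / 16 exceeds 1 / 2. Against intervals that halve in length the exponents therefore still grow,
    by the factor 9 / 8 per level.\<close>
  define \<tau> where "\<tau> = (\<lambda>e. t / 4 * (3 / 4) ^ (m - e))"
  define I where "I = (\<lambda>e (i::nat). \<rho> ` {b + i * 2 ^ e..<b + Suc i * 2 ^ e})"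
  define B where "B = (\<lambda>e i. {x \<in> space unit_M. \<tau> e \<le> \<bar>T (I e i) x\<bar>})"
  have D0: "0 < D" using D_ge by linarith
  have sets: "B e i \<in> sets unit_M" for e i unfolding B_def by (rule T_abs_sets)
  have sumtau: "(\<Sum>e<m. \<tau> e) < t"
  proof -
    have "(\<Sum>e<m. \<tau> e) = t / 4 * (\<Sum>e<m. (3 / 4) ^ (m - e))" by (simp add: \<tau>_def sum_distrib_left)
    also have "\<dots> \<le> t / 4 * 3" using sum_power_diff_le[of "3 / 4" m] t by (intro mult_left_mono) auto
    also have "\<dots> < t" using t by simp
    finally show ?thesis .
  qed
  have "\<P>(x in unit_M. \<exists>j<2 ^ m. t \<le> \<bar>T (\<rho> ` {b..<b + j}) x\<bar>)
     \<le> unit_M.prob (\<Union>e<m. \<Union>i<2 ^ (m - e). B e i)"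
  proof (rule unit_M.finite_measure_mono)
    show "{x \<in> space unit_M. \<exists>j<2 ^ m. t \<le> \<bar>T (\<rho> ` {b..<b + j}) x\<bar>}
      \<subseteq> (\<Union>e<m. \<Union>i<2 ^ (m - e). B e i)"
    proof (rule subsetI, rule ccontr)
      fix x assume x: "x \<in> {x \<in> space unit_M. \<exists>j<2 ^ m. t \<le> \<bar>T (\<rho> ` {b..<b + j}) x\<bar>}"
        and nB: "x \<notin> (\<Union>e<m. \<Union>i<2 ^ (m - e). B e i)"
      then obtain j where j: "j < 2 ^ m" "t \<le> \<bar>T (\<rho> ` {b..<b + j}) x\<bar>" by blast
      define g where "g = (\<lambda>k. T (\<rho> ` {..<k}) x)"
      have "\<bar>g (b + j) - g b\<bar> \<le> (\<Sum>e<m. \<tau> e)"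
      proof (rule dyadic_chaining[OF _ j(1)])
        fix e i :: nat assume e: "e < m" "Suc i * 2 ^ e \<le> 2 ^ m"
        have "(2::nat) ^ m = 2 ^ (m - e) * 2 ^ e" using e by (simp add: power_add[symmetric])
        with e have "Suc i \<le> 2 ^ (m - e)" by (metis mult_le_cancel2 zero_less_numeral zero_less_power)
        then have "x \<notin> B e i" using nB e by auto
        then have "\<bar>T (I e i) x\<bar> < \<tau> e" using x by (simp add: B_def not_le)
        moreover have "g (b + Suc i * 2 ^ e) - g (b + i * 2 ^ e) = T (I e i) x"
          unfolding g_def I_def by (intro T_image_diff \<rho>) simp
        ultimately show "\<bar>g (b + Suc i * 2 ^ e) - g (b + i * 2 ^ e)\<bar> \<le> \<tau> e" by simp
      qed
      then show False using sumtau j(2) T_image_diff[OF \<rho>, of b "b + j" x] by (simp add: g_def)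
    qed
    show "(\<Union>e<m. \<Union>i<2 ^ (m - e). B e i) \<in> sets unit_M"
      by (intro sets.finite_UN finite_lessThan sets)
  qed
  also have "\<dots> \<le> (\<Sum>e<m. unit_M.prob (\<Union>i<2 ^ (m - e). B e i))"
    by (intro measure_UNION_le finite_lessThan sets.finite_UN sets)
  also have "\<dots> \<le> (\<Sum>e<m. \<Sum>i<(2::nat) ^ (m - e). unit_M.prob (B e i))"
    by (intro sum_mono measure_UNION_le finite_lessThan sets)
  also have "\<dots> \<le> (\<Sum>e<m. D * exp (- y) * (1 / 2) ^ (m - e))"
  proof (rule sum_mono)
    fix e assume "e \<in> {..<m}"
    then have e: "e < m" by simp
    define h where "h = m - e"
    have m: "(2::real) ^ m = 2 ^ h * 2 ^ e" using e by (simp add: h_def power_add[symmetric])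
    have \<tau>: "(\<tau> e)\<^sup>2 / (D * 2 ^ e) = y * (9 / 8) ^ h"
    proof -
      have "(\<tau> e)\<^sup>2 = t\<^sup>2 / 16 * (9 / 16) ^ h"
      proof -
        have "((3 / 4 :: real) ^ h)\<^sup>2 = (9 / 16) ^ h"
          by (simp add: power2_eq_square power_mult_distrib[symmetric])
        moreover have "(t / 4 * c)\<^sup>2 = t\<^sup>2 / 16 * c\<^sup>2" for c by (simp add: power2_eq_square)
        ultimately show ?thesis unfolding \<tau>_def h_def[symmetric] by metis
      qed
      also have "(9 / 16 :: real) ^ h = (9 / 8) ^ h / 2 ^ h" by (simp add: power_divide[symmetric])
      finally have "(\<tau> e)\<^sup>2 = t\<^sup>2 / 16 * ((9 / 8) ^ h / 2 ^ h)" .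
      moreover have "t\<^sup>2 / 16 * (c / d) / (D * f) = t\<^sup>2 / (16 * D * (d * f)) * c" for c d f :: real
        by simp
      ultimately show ?thesis unfolding y(1) m by simp
    qed
    have one: "unit_M.prob (B e i) \<le> D * (exp (- y) * (1 / 4) ^ h)" for i
    proof -
      have "unit_M.prob (B e i) \<le> D * exp (- (\<tau> e)\<^sup>2 / (D * 2 ^ e))"
        unfolding B_def
      proof (rule T_tail_crude)
        show "finite (I e i)" by (simp add: I_def)
        have "card (I e i) \<le> 2 ^ e" unfolding I_def by (rule order.trans[OF card_image_le]) auto
        then show "real (card (I e i)) \<le> 2 ^ e"
          by (metis of_nat_le_iff of_nat_numeral of_nat_power)
      qed (use t in \<open>auto simp: \<tau>_def\<close>)
      also have "- (\<tau> e)\<^sup>2 / (D * 2 ^ e) \<le> - y - real h * 2"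
      proof -
        \<comment> \<open>With y \<ge> 16, Bernoulli's inequality yields y * (9 / 8)^h \<ge> y + 2 *
          h. The gain exp (- 2 * h) \<le> 4^(- h) beats the 2^h intervals of the level.\<close>
        have "1 + real h * (1 / 8) \<le> (1 + 1 / 8) ^ h" by (rule Bernoulli_inequality) simp
        then have "y * (1 + real h * (1 / 8)) \<le> y * (9 / 8) ^ h"
          using y(2) by (intro mult_left_mono) auto
        moreover have "real h * 16 \<le> real h * y" using y(2) by (intro mult_left_mono) auto
        ultimately show ?thesis using \<tau> by (simp add: algebra_simps)
      qed
      also have "exp (- y - real h * 2) = exp (- y) * exp (- 2) ^ h"
        by (simp add: exp_diff exp_of_nat_mult exp_minus divide_inverse power_inverse)
      also have "exp (- y) * exp (- 2) ^ h \<le> exp (- y) * (1 / 4) ^ h"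
      proof -
        have "(2::real) ^ 2 \<le> exp 1 ^ 2" using exp_ge_add_one_self[of 1] by (intro power_mono) auto
        then have "4 \<le> exp (2::real)" by (simp add: exp_of_nat_mult[symmetric])
        then have "exp (- 2 :: real) \<le> 1 / 4" by (simp add: exp_minus divide_simps)
        then show ?thesis by (intro mult_left_mono power_mono) auto
      qed
      finally show ?thesis using D0 by simp
    qed
    have "(\<Sum>i<(2::nat) ^ (m - e). unit_M.prob (B e i)) \<le> (\<Sum>i<(2::nat) ^ h. D * (exp (- y) * (1 / 4) ^ h))"
      unfolding h_def[symmetric] by (intro sum_mono one)
    also have "\<dots> = D * exp (- y) * (2 ^ h * (1 / 4) ^ h)" by simp
    also have "(2::real) ^ h * (1 / 4) ^ h = (1 / 2) ^ h" by (simp add: power_mult_distrib[symmetric])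
    finally show "(\<Sum>i<(2::nat) ^ (m - e). unit_M.prob (B e i)) \<le> D * exp (- y) * (1 / 2) ^ (m - e)"
      by (simp add: h_def)
  qed
  also have "\<dots> = D * exp (- y) * (\<Sum>e<m. (1 / 2) ^ (m - e))" by (simp add: sum_distrib_left)
  also have "\<dots> \<le> D * exp (- y) * 1"
    using sum_power_diff_le[of "1 / 2" m] D0 by (intro mult_left_mono) auto
  finally show ?thesis by simp
qed

end

section \<open>The upper bound\<close>

text \<open>The scale sqrt (2 * V * ln (ln N)) for the variance V = N / 2. Against it the constant
  of the law is 1; the factor 1 / sqrt 2 appears only in \<open>T_lil\<close>.\<close>

definition \<phi> :: "nat \<Rightarrow> real" where
  "\<phi> N = sqrt (real N * ln (ln (real N)))"

lemma eventually_lnln_ge: "\<forall>\<^sub>F N in sequentially. c \<le> ln (ln (real N))"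
proof -
  have "filterlim (\<lambda>N::nat. ln (ln (real N))) at_top sequentially" by real_asymp
  then show ?thesis by (simp add: filterlim_at_top)
qed

lemma eventually_\<phi>_le:
  assumes "0 < \<delta>"
  shows "\<forall>\<^sub>F N in sequentially. c * \<phi> N \<le> \<delta> * real N"
proof -
  have "(\<lambda>N. c * (sqrt (real N * ln (ln (real N))) / real N)) \<longlonglongrightarrow> c * 0"
    by (rule tendsto_mult_left) real_asymp
  then have "\<forall>\<^sub>F N in sequentially. c * (sqrt (real N * ln (ln (real N))) / real N) < \<delta>"
    using assms by (intro order_tendstoD(2)) auto
  then show ?thesis
    using eventually_gt_at_top[of 0]
  proof eventually_elim
    case (elim N)
    then show ?case by (simp add: \<phi>_def divide_simps split: if_splits)
  qed
qed

lemma \<phi>_mono: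
  assumes "0 < ln (ln (real M))" "M \<le> N"
  shows "\<phi> M \<le> \<phi> N"
proof -
  have M: "1 < real M"
  proof (rule ccontr)
    assume "\<not> 1 < real M"
    then have "M = 0 \<or> M = 1" by (cases M) auto
    then show False using assms by auto
  qed
  then have lnM: "0 < ln (real M)" by simp
  have "ln (real M) \<le> ln (real N)" using assms M by simp
  then have "ln (ln (real M)) \<le> ln (ln (real N))" using lnM by simp
  then show ?thesis unfolding \<phi>_def using assms by (intro real_sqrt_le_mono mult_mono) auto
qed

text \<open>i holds the r + 1 leading binary digits of N. The checkpoints i * 2^m number 2^r per
  dyadic scale and approximate N up to the relative error 2^(- r).\<close>

lemma dyadic_decomposition:
  fixes N r k0 :: nat
  assumes "2 ^ (k0 + r) \<le> N"
  obtains m i j where "k0 \<le> m" "i \<in> {2 ^ r..<2 ^ (r + 1)}" "j < 2 ^ m" "N = i * 2 ^ m + j"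
proof -
  have "1 \<le> N" using assms by (metis le_trans one_le_numeral one_le_power)
  then obtain k where k: "2 ^ k \<le> N" "N < 2 ^ (k + 1)" using ex_power_ivl1[of 2 N] by auto
  have "(2::nat) ^ (k0 + r) < 2 ^ (k + 1)" using assms k(2) by linarith
  then have k0: "k0 + r \<le> k" using power_less_imp_less_exp[of "2::nat" "k0 + r" "k + 1"] by simp
  define m where "m = k - r"
  have p: "(2::nat) ^ k = 2 ^ r * 2 ^ m" "(2::nat) ^ (k + 1) = 2 ^ (r + 1) * 2 ^ m"
    using k0 by (auto simp: m_def power_add[symmetric])
  have "2 ^ r \<le> N div 2 ^ m" using k(1) unfolding p by (simp add: less_eq_div_iff_mult_less_eq)
  moreover have "N div 2 ^ m < 2 ^ (r + 1)" using k(2) unfolding p by (simp add: div_less_iff_less_mult)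
  moreover have "k0 \<le> m" using k0 by (simp add: m_def)
  moreover have "N = N div 2 ^ m * 2 ^ m + N mod 2 ^ m" by (rule div_mult_mod_eq[symmetric])
  ultimately show ?thesis using that[of m "N div 2 ^ m" "N mod 2 ^ m"] by simp
qed

context lacunary
begin

text \<open>Borel-Cantelli over the dyadic scales m: the sharp tail controls the checkpoints, the
  maximal inequality the stretch up to the next one. Both probabilities are of order m^(- \<gamma>)
  with \<gamma> > 1, and each scale has a bounded number of checkpoints.\<close>

theorem T_upper:
  fixes \<rho> :: "nat \<Rightarrow> nat"
  assumes \<rho>: "inj \<rho>" and \<epsilon>: "0 < \<epsilon>" "\<epsilon> < 1"
  shows "AE x in unit_M. \<forall>\<^sub>F N in sequentially. \<bar>T (\<rho> ` {..<N}) x\<bar> \<le> (1 + \<epsilon>) * \<phi> N"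
proof -
  \<comment> \<open>Chosen so that (1 - \<eta>) * \<gamma>^2 \<ge> \<gamma> for \<gamma> = 1 +
    \<epsilon> / 2.\<close>
  define \<eta> where "\<eta> = \<epsilon> / 4"
  have \<eta>: "0 < \<eta>" "\<eta> < 1" using \<epsilon> by (auto simp: \<eta>_def)
  obtain \<delta> K where \<delta>: "0 < \<delta>" and K: "0 < K" and sharp:
    "\<And>A N t. finite A \<Longrightarrow> real (card A) \<le> N \<Longrightarrow> 0 < N \<Longrightarrow> 0 < t \<Longrightarrow> t \<le> \<delta> * N \<Longrightarrow>
       \<P>(x in unit_M. t \<le> \<bar>T A x\<bar>) \<le> K * exp (- (1 - \<eta>) * t\<^sup>2 / N)"
    by (rule T_tail_sharp[OF \<eta>]) (rule that)
  have D0: "0 < D" using D_ge by linarith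
  \<comment> \<open>For i \<ge> 2^r this gives \<epsilon>^2 * i / (64 * D) \<ge> 2, so the exponent
    y of the maximal inequality is at least 2 * ln (ln M).\<close>
  obtain r where r: "128 * D / \<epsilon>\<^sup>2 < 2 ^ r" using real_arch_pow[of 2 "128 * D / \<epsilon>\<^sup>2"] by auto
  \<comment> \<open>The 8 yields y \<ge> 16 in \<open>T_maximal\<close>; the second part keeps the
    threshold in the range of the sharp tail.\<close>
  obtain M0 where M0: "\<And>M. M0 \<le> M \<Longrightarrow> 8 \<le> ln (ln (real M)) \<and> (1 + \<epsilon> / 2) * \<phi> M \<le> \<delta> * real M"
    using eventually_conj[OF eventually_lnln_ge[of 8] eventually_\<phi>_le[OF \<delta>, of "1 + \<epsilon> / 2"]]
    unfolding eventually_sequentially by blast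
  define m0 where "m0 = Suc M0"
  have m0: "M0 \<le> 2 ^ m0" "1 \<le> m0"
    using less_exp[of "Suc M0"] unfolding m0_def by linarith+
  define \<gamma> where "\<gamma> = 1 + \<epsilon> / 2"
  define A1 where "A1 = (\<lambda>M. {x \<in> space unit_M. \<gamma> * \<phi> M \<le> \<bar>T (\<rho> ` {..<M}) x\<bar>})"
  define A2 where "A2 = (\<lambda>m M. {x \<in> space unit_M. \<exists>j<2 ^ m. \<epsilon> / 2 * \<phi> M \<le> \<bar>T (\<rho> ` {M..<M + j}) x\<bar>})"
  define G where "G = (\<lambda>m. \<Union>i\<in>{2 ^ r..<2 ^ (r + 1)}. A1 (i * 2 ^ m) \<union> A2 m (i * 2 ^ m))"
  have A1_sets: "A1 M \<in> sets unit_M" for M unfolding A1_def by (rule T_abs_sets)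
  have A2_sets: "A2 m M \<in> sets unit_M" for m M
  proof -
    have eq: "A2 m M = (\<Union>j<2 ^ m. {x \<in> space unit_M. \<epsilon> / 2 * \<phi> M \<le> \<bar>T (\<rho> ` {M..<M + j}) x\<bar>})"
      by (auto simp: A2_def)
    show ?thesis unfolding eq by (intro sets.finite_UN finite_lessThan T_abs_sets)
  qed
  have G_sets: "G m \<in> sets unit_M" for m
    unfolding G_def by (intro sets.finite_UN sets.Un A1_sets A2_sets) simp
  have prob_le: "unit_M.prob (A1 M) + unit_M.prob (A2 m M) \<le> (K + D) * (real m / 2) powr (- \<gamma>)"
    if m: "m0 \<le> m" and i: "2 ^ r \<le> i" and M: "M = i * 2 ^ m" for m i M
  proof -
    have "(1::nat) \<le> i" using i by (metis le_trans one_le_numeral one_le_power)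
    then have M2: "2 ^ m \<le> M" unfolding M by simp
    have "(2::nat) ^ m0 \<le> 2 ^ m" using m by (intro power_increasing) auto
    then have "M0 \<le> M" using m0 M2 by linarith
    then have LL: "8 \<le> ln (ln (real M))" and \<phi>\<delta>: "\<gamma> * \<phi> M \<le> \<delta> * real M"
      using M0 by (auto simp: \<gamma>_def)
    have Mpos: "0 < real M" using \<open>1 \<le> i\<close> by (simp add: M)
    have \<phi>2: "(\<phi> M)\<^sup>2 = real M * ln (ln (real M))" unfolding \<phi>_def using LL by simp
    have \<phi>0: "0 < \<phi> M" unfolding \<phi>_def using LL Mpos by simp
    \<comment> \<open>w = (ln M)^(- \<gamma>), and ln M \<ge> m * ln 2 \<ge> m / 2 because M \<ge>
      2^m.\<close>
    define w where "w = exp (- \<gamma> * ln (ln (real M)))"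
    have "unit_M.prob (A1 M) \<le> K * exp (- (1 - \<eta>) * (\<gamma> * \<phi> M)\<^sup>2 / real M)"
      unfolding A1_def
    proof (rule sharp[OF _ _ Mpos _ \<phi>\<delta>])
      show "real (card (\<rho> ` {..<M})) \<le> real M" using card_image_le[of "{..<M}" \<rho>] by simp
    qed (use \<phi>0 \<epsilon> in \<open>auto simp: \<gamma>_def\<close>)
    also have "- (1 - \<eta>) * (\<gamma> * \<phi> M)\<^sup>2 / real M = - ((1 - \<eta>) * \<gamma>\<^sup>2) * ln (ln (real M))"
    proof -
      have "- c * (d * (real M * e)) / real M = - (c * d) * e" for c d e :: real using Mpos by simp
      then show ?thesis unfolding power_mult_distrib \<phi>2 .
    qed
    also have "exp (- ((1 - \<eta>) * \<gamma>\<^sup>2) * ln (ln (real M))) \<le> w"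
    proof -
      have "(1 - \<eta>) * \<gamma>\<^sup>2 = \<gamma> + \<epsilon> * (4 - \<epsilon>\<^sup>2) / 16"
        by (simp add: \<eta>_def \<gamma>_def power2_eq_square field_simps)
      moreover have "\<epsilon>\<^sup>2 \<le> 1\<^sup>2" using \<epsilon> by (intro power_mono) auto
      ultimately have "\<gamma> \<le> (1 - \<eta>) * \<gamma>\<^sup>2" using \<epsilon> by simp
      then have "\<gamma> * ln (ln (real M)) \<le> (1 - \<eta>) * \<gamma>\<^sup>2 * ln (ln (real M))"
        using LL by (intro mult_right_mono) auto
      then show ?thesis by (simp add: w_def)
    qed
    finally have p1: "unit_M.prob (A1 M) \<le> K * w" using K by simp
    define y where "y = (\<epsilon> / 2 * \<phi> M)\<^sup>2 / (16 * D * 2 ^ m)"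
    have y: "2 * ln (ln (real M)) \<le> y"
    proof -
      have "y = \<epsilon>\<^sup>2 * real i / (64 * D) * ln (ln (real M))"
        unfolding y_def power_mult_distrib \<phi>2 using D0 by (simp add: power_divide M)
      moreover have "2 \<le> \<epsilon>\<^sup>2 * real i / (64 * D)"
      proof -
        have "128 * D < \<epsilon>\<^sup>2 * 2 ^ r" using r \<epsilon> by (simp add: field_simps)
        also have "\<dots> \<le> \<epsilon>\<^sup>2 * real i"
          using i by (intro mult_left_mono) auto
        finally show ?thesis using D0 by (simp add: field_simps)
      qed
      then have "2 * ln (ln (real M)) \<le> \<epsilon>\<^sup>2 * real i / (64 * D) * ln (ln (real M))"
        using LL by (intro mult_right_mono) auto
      ultimately show ?thesis by simp
    qed
    have "unit_M.prob (A2 m M) \<le> D * exp (- y)"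
      unfolding A2_def using \<phi>0 \<epsilon> y LL by (intro T_maximal[OF \<rho> _ y_def]) auto
    also have "exp (- y) \<le> w"
    proof -
      have "\<gamma> * ln (ln (real M)) \<le> 2 * ln (ln (real M))"
        using \<epsilon> LL by (intro mult_right_mono) (auto simp: \<gamma>_def)
      then show ?thesis using y by (simp add: w_def)
    qed
    finally have p2: "unit_M.prob (A2 m M) \<le> D * w" using D0 by simp
    have "w \<le> (real m / 2) powr (- \<gamma>)"
    proof -
      have "real m / 2 \<le> real m * ln 2" using ln2_ge_two_thirds mult_left_mono[of "1 / 2" "ln 2" "real m"] by simp
      also have "\<dots> = ln (2 ^ m)" by (simp add: ln_realpow)
      also have "\<dots> \<le> ln (real M)"
      proof -
        have "(2::real) ^ m \<le> real M" using M2 by simp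
        then show ?thesis using Mpos by simp
      qed
      finally have "real m / 2 \<le> ln (real M)" .
      moreover have "0 < real m / 2" using m m0 by simp
      ultimately have "ln (real M) powr (- \<gamma>) \<le> (real m / 2) powr (- \<gamma>)"
        using \<epsilon> by (intro powr_mono2') (auto simp: \<gamma>_def)
      moreover have "w = ln (real M) powr (- \<gamma>)"
        using \<open>0 < real m / 2\<close> \<open>real m / 2 \<le> ln (real M)\<close> by (simp add: w_def powr_def)
      ultimately show ?thesis by simp
    qed
    then have "(K + D) * w \<le> (K + D) * (real m / 2) powr (- \<gamma>)"
      using K D0 by (intro mult_left_mono) auto
    then show ?thesis using p1 p2 by (simp add: distrib_right)
  qed
  have G_le: "unit_M.prob (G m) \<le> 2 ^ r * (K + D) * 2 powr \<gamma> * real m powr (- \<gamma>)" if "m0 \<le> m" for m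
  proof -
    have "unit_M.prob (G m) \<le> (\<Sum>i\<in>{2 ^ r..<2 ^ (r + 1)}. unit_M.prob (A1 (i * 2 ^ m) \<union> A2 m (i * 2 ^ m)))"
      unfolding G_def by (intro measure_UNION_le sets.Un A1_sets A2_sets) simp
    also have "\<dots> \<le> (\<Sum>i\<in>{2 ^ r..<2 ^ (r + 1) :: nat}. (K + D) * (real m / 2) powr (- \<gamma>))"
    proof (rule sum_mono)
      fix i :: nat assume "i \<in> {2 ^ r..<2 ^ (r + 1)}"
      then have "unit_M.prob (A1 (i * 2 ^ m)) + unit_M.prob (A2 m (i * 2 ^ m)) \<le> (K + D) * (real m / 2) powr (- \<gamma>)"
        by (intro prob_le[OF that _ refl]) simp
      moreover have "unit_M.prob (A1 (i * 2 ^ m) \<union> A2 m (i * 2 ^ m)) \<le> unit_M.prob (A1 (i * 2 ^ m)) + unit_M.prob (A2 m (i * 2 ^ m))"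
        by (rule measure_Un_le[OF A1_sets A2_sets])
      ultimately show "unit_M.prob (A1 (i * 2 ^ m) \<union> A2 m (i * 2 ^ m)) \<le> (K + D) * (real m / 2) powr (- \<gamma>)"
        by linarith
    qed
    also have "\<dots> = 2 ^ r * ((K + D) * (real m / 2) powr (- \<gamma>))" by simp
    also have "(real m / 2) powr (- \<gamma>) = 2 powr \<gamma> * real m powr (- \<gamma>)"
      by (simp add: powr_divide powr_minus_divide)
    finally show ?thesis by (simp only: mult.assoc)
  qed
  have "summable (\<lambda>m. unit_M.prob (G m))"
  proof (rule summable_comparison_test_ev)
    show "\<forall>\<^sub>F m in sequentially. norm (unit_M.prob (G m)) \<le> 2 ^ r * (K + D) * 2 powr \<gamma> * real m powr (- \<gamma>)"
      using eventually_ge_at_top[of m0] by eventually_elim (use G_le in simp)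
    show "summable (\<lambda>m. 2 ^ r * (K + D) * 2 powr \<gamma> * real m powr (- \<gamma>))"
      using \<epsilon> by (intro summable_mult) (simp add: summable_real_powr_iff \<gamma>_def)
  qed
  then have "AE x in unit_M. \<forall>\<^sub>F m in sequentially. x \<in> space unit_M - G m"
    using G_sets by (intro borel_cantelli_AE1) (auto simp: unit_M.emeasure_eq_measure)
  then show ?thesis
  proof eventually_elim
    case (elim x)
    then obtain m1 where m1: "\<And>m. m1 \<le> m \<Longrightarrow> x \<in> space unit_M - G m"
      unfolding eventually_sequentially by metis
    show ?case
    proof (rule eventually_sequentiallyI)
      fix N :: nat assume "2 ^ (max m0 m1 + r) \<le> N"
      then obtain m i j where m: "max m0 m1 \<le> m" and i: "i \<in> {2 ^ r..<2 ^ (r + 1)}"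
        and j: "j < 2 ^ m" and N: "N = i * 2 ^ m + j"
        by (rule dyadic_decomposition)
      define M where "M = i * 2 ^ m"
      have "(1::nat) \<le> i" using i by (metis atLeastLessThan_iff le_trans one_le_numeral one_le_power)
      then have "2 ^ m \<le> M" unfolding M_def by simp
      moreover have "(2::nat) ^ m0 \<le> 2 ^ m" using m by (intro power_increasing) auto
      ultimately have "M0 \<le> M" using m0 by linarith
      then have LL: "8 \<le> ln (ln (real M))" using M0 by blast
      have x: "x \<in> space unit_M" "x \<notin> A1 M" "x \<notin> A2 m M"
        using m1[of m] m i by (auto simp: G_def M_def)
      have "\<bar>T (\<rho> ` {..<M}) x\<bar> < \<gamma> * \<phi> M" using x by (simp add: A1_def not_le)
      moreover have "\<bar>T (\<rho> ` {M..<M + j}) x\<bar> < \<epsilon> / 2 * \<phi> M" using x j by (auto simp: A2_def not_le)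
      moreover have "T (\<rho> ` {..<N}) x - T (\<rho> ` {..<M}) x = T (\<rho> ` {M..<M + j}) x"
        unfolding N M_def[symmetric] by (intro T_image_diff \<rho>) simp
      ultimately have "\<bar>T (\<rho> ` {..<N}) x\<bar> \<le> \<gamma> * \<phi> M + \<epsilon> / 2 * \<phi> M" by linarith
      also have "\<dots> = (1 + \<epsilon>) * \<phi> M" by (simp add: \<gamma>_def field_simps)
      also have "\<dots> \<le> (1 + \<epsilon>) * \<phi> N"
        using \<epsilon> LL by (intro mult_left_mono \<phi>_mono) (auto simp: N M_def)
      finally show "\<bar>T (\<rho> ` {..<N}) x\<bar> \<le> (1 + \<epsilon>) * \<phi> N" .
    qed
  qed
qed

end

section \<open>The lower bound\<close>

text \<open>
  Second moment method: the partial sums of \<open>h\<close> have mean about \<open>C = \<Sum> c\<close> and variance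
  \<open>o(C\<^sup>2)\<close>, so they cannot vanish on a set of positive probability.
\<close>

lemma (in prob_space) weighted_borel_cantelli:
  fixes h :: "nat \<Rightarrow> 'a \<Rightarrow> real" and c :: "nat \<Rightarrow> real"
  assumes h[measurable]: "\<And>k. h k \<in> borel_measurable M"
    and h01: "\<And>k x. 0 \<le> h k x" "\<And>k x. h k x \<le> 1"
    and le: "\<And>k. expectation (h k) \<le> c k"
    and cross: "\<And>k l. k \<noteq> l \<Longrightarrow> expectation (\<lambda>x. h k x * h l x) \<le> c k * c l"
    and ge: "\<And>\<eta>. 0 < \<eta> \<Longrightarrow> \<forall>\<^sub>F k in sequentially. (1 - \<eta>) * c k \<le> expectation (h k)"
    and c: "\<not> summable c"
  shows "AE x in M. \<exists>\<^sub>F k in sequentially. 0 < h k x"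
proof -
  have int1: "integrable M (h k)" for k
    by (rule integrable_const_bound[of _ 1]) (use h01 in auto)
  have int2: "integrable M (\<lambda>x. h k x * h l x)" for k l
    by (rule integrable_const_bound[of _ 1]) (simp_all add: h01 mult_le_one)
  have c0: "0 \<le> c k" for k
  proof -
    have "0 \<le> expectation (h k)" by (intro integral_nonneg_AE AE_I2 h01)
    then show ?thesis using le[of k] by linarith
  qed
  define B where "B = (\<lambda>K. {x \<in> space M. \<forall>k\<ge>K. h k x = 0})"
  have B_sets[measurable]: "B K \<in> sets M" for K unfolding B_def by measurable
  have B_le: "prob (B K) \<le> 3 * \<eta>" if \<eta>: "0 < \<eta>" for K \<eta>
  proof -
    obtain K0 where K0: "\<And>k. K0 \<le> k \<Longrightarrow> (1 - \<eta>) * c k \<le> expectation (h k)"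
      using ge[OF \<eta>] unfolding eventually_sequentially by blast
    define K1 where "K1 = max K K0"
    define C where "C = (\<lambda>n. \<Sum>k\<in>{K1..<n}. c k)"
    have "\<exists>n. 1 / \<eta> < C n"
    proof (rule ccontr)
      assume "\<not> (\<exists>n. 1 / \<eta> < C n)"
      then have Cn: "C n \<le> 1 / \<eta>" for n by (simp add: not_less)
      have "(\<Sum>k<n. c k) \<le> (\<Sum>k<K1. c k) + 1 / \<eta>" for n
      proof -
        have "(\<Sum>k<n. c k) \<le> (\<Sum>k\<in>{..<K1} \<union> {K1..<n}. c k)"
          by (intro sum_mono2) (auto simp: c0)
        also have "\<dots> = (\<Sum>k<K1. c k) + C n" unfolding C_def by (intro sum.union_disjoint) auto
        finally show ?thesis using Cn[of n] by linarith
      qed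
      then have "summable c" by (intro summableI_nonneg_bounded c0)
      then show False using c by simp
    qed
    \<comment> \<open>C > 1 / \<eta> makes the diagonal contribution C negligible: C < \<eta> *
      C^2.\<close>
    then obtain n where n: "1 / \<eta> < C n" by blast
    define Cn where "Cn = C n"
    have Cn: "0 < Cn" "1 < \<eta> * Cn"
      using n \<eta> less_trans[of 0 "1 / \<eta>" "C n"] by (auto simp: Cn_def field_simps)
    define Z where "Z = (\<lambda>x. \<Sum>k\<in>{K1..<n}. h k x)"
    have intZ: "integrable M Z" unfolding Z_def by (intro Bochner_Integration.integrable_sum int1)
    have Z2: "(Z x)\<^sup>2 = (\<Sum>k\<in>{K1..<n}. \<Sum>l\<in>{K1..<n}. h k x * h l x)" for x
      by (simp add: Z_def power2_eq_square sum_product)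
    have intZ2: "integrable M (\<lambda>x. (Z x)\<^sup>2)"
      unfolding Z2 by (intro Bochner_Integration.integrable_sum int2)
    have EZ: "(1 - \<eta>) * Cn \<le> expectation Z"
    proof -
      have "(1 - \<eta>) * Cn = (\<Sum>k\<in>{K1..<n}. (1 - \<eta>) * c k)" by (simp add: Cn_def C_def sum_distrib_left)
      also have "\<dots> \<le> (\<Sum>k\<in>{K1..<n}. expectation (h k))" by (intro sum_mono K0) (auto simp: K1_def)
      also have "\<dots> = expectation Z"
        unfolding Z_def by (rule Bochner_Integration.integral_sum[symmetric]) (rule int1)
      finally show ?thesis .
    qed
    have EZ2: "expectation (\<lambda>x. (Z x)\<^sup>2) \<le> Cn\<^sup>2 + Cn"
    proof -
      have pair: "expectation (\<lambda>x. h k x * h l x) \<le> c k * c l + (if k = l then c k else 0)" for k l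
      proof (cases "k = l")
        case True
        have "expectation (\<lambda>x. h k x * h k x) \<le> expectation (h k)"
          using h01 by (intro integral_mono int1 int2) (simp add: mult_left_le)
        also have "\<dots> \<le> c k * c k + c k" using le[of k] c0[of k] by (simp add: add_increasing)
        finally show ?thesis using True by simp
      next
        case False
        then show ?thesis using cross by simp
      qed
      have "expectation (\<lambda>x. (Z x)\<^sup>2) = (\<Sum>k\<in>{K1..<n}. \<Sum>l\<in>{K1..<n}. expectation (\<lambda>x. h k x * h l x))"
        unfolding Z2 by (simp add: Bochner_Integration.integral_sum int2 Bochner_Integration.integrable_sum)
      also have "\<dots> \<le> (\<Sum>k\<in>{K1..<n}. \<Sum>l\<in>{K1..<n}. c k * c l + (if k = l then c k else 0))"
        by (intro sum_mono pair)
      also have "\<dots> = Cn\<^sup>2 + Cn"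
        by (simp add: sum.distrib Cn_def C_def power2_eq_square sum_product)
      finally show ?thesis .
    qed
    \<comment> \<open>Chebyshev's inequality by hand, around Cn instead of the mean: on
      \<open>B K\<close> the sum Z vanishes, so (Z - Cn)^2 equals Cn^2 there.\<close>
    have "expectation (\<lambda>x. Cn\<^sup>2 * indicator (B K) x) \<le> expectation (\<lambda>x. (Z x)\<^sup>2 - 2 * Cn * Z x + Cn\<^sup>2)"
    proof (rule integral_mono)
      fix x
      have "Z x = 0" if "x \<in> B K" using that by (simp add: Z_def B_def K1_def)
      moreover have "(Z x)\<^sup>2 - 2 * Cn * Z x + Cn\<^sup>2 = (Z x - Cn)\<^sup>2"
        by (simp add: power2_eq_square algebra_simps)
      ultimately show "Cn\<^sup>2 * indicator (B K) x \<le> (Z x)\<^sup>2 - 2 * Cn * Z x + Cn\<^sup>2"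
        by (auto simp: indicator_def)
      show "integrable M (\<lambda>x. Cn\<^sup>2 * indicator (B K) x)"
        by (rule integrable_const_bound[of _ "Cn\<^sup>2"]) (auto simp: indicator_def)
      show "integrable M (\<lambda>x. (Z x)\<^sup>2 - 2 * Cn * Z x + Cn\<^sup>2)"
        by (intro Bochner_Integration.integrable_add Bochner_Integration.integrable_diff
            integrable_mult_right integrable_const intZ intZ2)
    qed
    then have "Cn\<^sup>2 * prob (B K) \<le> expectation (\<lambda>x. (Z x)\<^sup>2) - 2 * Cn * expectation Z + Cn\<^sup>2"
      using intZ intZ2 by (simp add: prob_space)
    also have "\<dots> \<le> (Cn\<^sup>2 + Cn) - 2 * Cn * ((1 - \<eta>) * Cn) + Cn\<^sup>2"
    proof -
      have "2 * Cn * ((1 - \<eta>) * Cn) \<le> 2 * Cn * expectation Z" using EZ Cn by (intro mult_left_mono) auto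
      then show ?thesis using EZ2 by linarith
    qed
    also have "\<dots> = 2 * \<eta> * Cn\<^sup>2 + Cn * 1" by (simp add: power2_eq_square algebra_simps)
    also have "\<dots> \<le> 2 * \<eta> * Cn\<^sup>2 + Cn * (\<eta> * Cn)" using Cn by (intro add_left_mono mult_left_mono) auto
    also have "\<dots> = Cn\<^sup>2 * (3 * \<eta>)" by (simp add: power2_eq_square)
    finally show ?thesis using Cn by simp
  qed
  have "prob (B K) = 0" for K
  proof (rule antisym)
    show "prob (B K) \<le> 0"
    proof (rule field_le_epsilon)
      fix e :: real assume "0 < e"
      then show "prob (B K) \<le> 0 + e" using B_le[of "e / 3" K] by simp
    qed
  qed simp
  then have "AE x in M. x \<notin> B K" for K
    by (intro AE_not_in) (simp add: null_sets_def emeasure_eq_measure)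
  then have "AE x in M. \<forall>K. x \<notin> B K" by (simp add: AE_all_countable)
  then show ?thesis
    using AE_space
  proof eventually_elim
    case (elim x)
    have "\<exists>k\<ge>K. 0 < h k x" for K
    proof -
      obtain k where "K \<le> k" "h k x \<noteq> 0" using elim by (auto simp: B_def)
      then show ?thesis using h01(1)[of k x] by (intro exI[of _ k]) auto
    qed
    then show ?case by (simp add: frequently_sequentially)
  qed
qed

section \<open>Truncated Riesz products and the extremal events\<close>

context lacunary
begin

lemma R_truncated_measurable:
  "(\<lambda>x. R L p \<theta> A x * indicator {x. R L p \<theta> A x \<le> c \<and> d \<le> T B x} x) \<in> borel_measurable unit_M"
proof -
  have "closed ({x. R L p \<theta> A x \<le> c} \<inter> {x. d \<le> T B x})"
    by (intro closed_Int closed_Collect_le R_continuous T_continuous continuous_intros)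
  moreover have "{x. R L p \<theta> A x \<le> c \<and> d \<le> T B x} = {x. R L p \<theta> A x \<le> c} \<inter> {x. d \<le> T B x}"
    by auto
  ultimately have "{x. R L p \<theta> A x \<le> c \<and> d \<le> T B x} \<in> sets borel" by simp
  then have "indicat_real {x. R L p \<theta> A x \<le> c \<and> d \<le> T B x} \<in> borel_measurable borel" by simp
  then show ?thesis
    by (rule borel_measurable_unit_M[OF borel_measurable_times[OF borel_measurable_continuous_onI[OF R_continuous]]])
qed

text \<open>Under the density R the block sum has mean \<theta> * N / 2, and ln R is typically near
  \<theta>^2 * N / 4 \<le> (1 - \<delta>)^2 * l. Both ways to leave the event are therefore large
  deviations, and each gets an exponential Markov bound from
  \<open>expectation_tilted_le\<close>.\<close>

lemma expectation_R_truncated: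
  assumes pL: "p < L" "s < L" and A: "finite A" "real (card A) \<le> n"
    and \<theta>: "0 < \<theta>" "6400 * \<theta> * (real L)\<^sup>2 \<le> \<delta>\<^sup>2" and \<delta>: "0 < \<delta>" "\<delta> \<le> 1 / 2"
    and l: "0 \<le> l" and n: "\<theta>\<^sup>2 * n = 4 * (1 - \<delta>)\<^sup>2 * l" and \<psi>: "\<theta> * \<psi> = 2 * (1 - \<delta>) * l"
  shows "1 - 2 * exp (- \<delta>\<^sup>2 / 4 * l) \<le> unit_M.expectation (\<lambda>x. R L p \<theta> A x *
    indicator {x. R L p \<theta> A x \<le> exp l \<and> \<theta> * card (big L p A) / 2 - \<delta> * \<psi> \<le> T (big L p A) x} x)"
proof -
  define N where "N = real (card (big L p A))"
  define r where "r = R L p \<theta> A"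
  define Y where "Y = T (big L p A)"
  define F where "F = {x. r x \<le> exp l \<and> \<theta> * N / 2 - \<delta> * \<psi> \<le> Y x}"
  \<comment> \<open>\<open>G1\<close> handles R > exp l through the moment R^(1 + \<delta> / 2), and
    \<open>G2\<close> handles a small sum through the tilt - \<delta>; \<open>a1\<close> and
    \<open>a2\<close> are the Markov normalisations.\<close>
  define e1 where "e1 = 1 + \<delta> / 2"
  define G1 where "G1 = (\<lambda>x. r x powr e1 * exp (0 * (\<theta> * Y x)))"
  define G2 where "G2 = (\<lambda>x. r x powr 1 * exp (- \<delta> * (\<theta> * Y x)))"
  define a1 where "a1 = exp (- (\<delta> / 2 * l))"
  define a2 where "a2 = exp (\<delta> * \<theta> * (\<theta> * N / 2 - \<delta> * \<psi>))"
  define w where "w = exp (- \<delta>\<^sup>2 / 4 * l)"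
  have "1 \<le> real L" using pL by simp
  then have "\<theta> * real L \<le> \<theta> * (real L)\<^sup>2" using \<theta> by (intro mult_left_mono) (auto simp: power2_eq_square)
  moreover have "\<delta>\<^sup>2 \<le> (1 / 2)\<^sup>2" using \<delta> by (intro power_mono) auto
  then have \<delta>2: "\<delta>\<^sup>2 \<le> 1 / 4" by (simp add: power2_eq_square)
  ultimately have "\<theta> * real L \<le> 1 / 16" using \<theta> by linarith
  then have \<theta>L: "\<bar>\<theta>\<bar> * real L \<le> 1 / 16" using \<theta> by simp
  have N0: "0 \<le> N" by (simp add: N_def)
  have "card (big L p A) \<le> card A" by (intro card_mono A big_subset)
  then have Nn: "N \<le> n" using A by (simp add: N_def)
  have \<theta>N: "\<theta>\<^sup>2 * N \<le> 4 * (1 - \<delta>)\<^sup>2 * l"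
    using mult_left_mono[OF Nn, of "\<theta>\<^sup>2"] n by simp
  have "(1 - \<delta>)\<^sup>2 * l \<le> 1 * l" using \<delta> l by (intro mult_right_mono power_le_one) auto
  then have \<theta>Nl: "\<theta>\<^sup>2 * N \<le> 4 * l" using \<theta>N by simp
  \<comment> \<open>6400 = 16 * 400, and \<theta>^2 * N \<le> 4 * l.\<close>
  have err: "400 * \<bar>\<theta>\<bar> ^ 3 * (real L)\<^sup>2 * N \<le> \<delta>\<^sup>2 / 4 * l"
  proof -
    have "400 * \<bar>\<theta>\<bar> ^ 3 * (real L)\<^sup>2 * N = (400 * \<theta> * (real L)\<^sup>2) * (\<theta>\<^sup>2 * N)"
      using \<theta> by (simp add: power2_eq_square power3_eq_cube)
    also have "\<dots> \<le> (\<delta>\<^sup>2 / 16) * (4 * l)"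
    proof (rule mult_mono[OF _ \<theta>Nl])
      show "400 * \<theta> * (real L)\<^sup>2 \<le> \<delta>\<^sup>2 / 16" using \<theta> by linarith
    qed (use N0 in simp_all)
    also have "(\<delta>\<^sup>2 / 16) * (4 * l) = \<delta>\<^sup>2 / 4 * l" by simp
    finally show ?thesis .
  qed
  have rpos: "0 < r x" for x unfolding r_def by (rule R_pos[OF pL \<theta>L])
  have int_r: "integrable unit_M r" unfolding r_def by (intro integrable_unit_M R_continuous)
  have int1: "integrable unit_M G1" and E1: "unit_M.expectation G1
      \<le> exp (((e1 + 0)\<^sup>2 - e1) / 4 * \<theta>\<^sup>2 * N + 400 * \<bar>\<theta>\<bar> ^ 3 * (real L)\<^sup>2 * N)"
    unfolding G1_def r_def Y_def N_def using \<delta>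
    by (intro expectation_tilted_le[OF pL A(1) \<theta>L]; simp add: e1_def)+
  have int2: "integrable unit_M G2" and E2: "unit_M.expectation G2
      \<le> exp (((1 + - \<delta>)\<^sup>2 - 1) / 4 * \<theta>\<^sup>2 * N + 400 * \<bar>\<theta>\<bar> ^ 3 * (real L)\<^sup>2 * N)"
    unfolding G2_def r_def Y_def N_def using \<delta>
    by (intro expectation_tilted_le[OF pL A(1) \<theta>L]; simp)+
  have int_F: "integrable unit_M (\<lambda>x. r x * indicator F x)"
    unfolding F_def r_def Y_def
    by (rule Bochner_Integration.integrable_bound[OF int_r[unfolded r_def] R_truncated_measurable])
      (rule AE_I2, simp add: abs_mult mult_left_le)
  \<comment> \<open>Pointwise: outside \<open>F\<close> one of the two Markov terms is at least r,
    and both are nonnegative everywhere.\<close>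
  have "unit_M.expectation (\<lambda>x. r x - a1 * G1 x - a2 * G2 x) \<le> unit_M.expectation (\<lambda>x. r x * indicator F x)"
  proof (rule integral_mono)
    fix x
    have G1: "a1 * G1 x = r x * (r x / exp l) powr (\<delta> / 2)"
    proof -
      have "(r x / exp l) powr (\<delta> / 2) = r x powr (\<delta> / 2) / exp (\<delta> / 2 * l)"
        using rpos[of x] by (simp add: powr_divide exp_powr_real mult.commute)
      moreover have "r x powr e1 = r x * r x powr (\<delta> / 2)"
        using rpos[of x] by (simp add: e1_def powr_add)
      moreover have "a1 = 1 / exp (\<delta> / 2 * l)" by (simp add: a1_def exp_minus inverse_eq_divide)
      ultimately show ?thesis by (simp add: G1_def)
    qed
    have G2: "a2 * G2 x = r x * exp (\<delta> * \<theta> * (\<theta> * N / 2 - \<delta> * \<psi> - Y x))"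
      using rpos[of x] by (simp add: a2_def G2_def exp_add[symmetric] algebra_simps)
    consider "x \<in> F" | "exp l < r x" | "Y x < \<theta> * N / 2 - \<delta> * \<psi>"
      unfolding F_def mem_Collect_eq by linarith
    then show "r x - a1 * G1 x - a2 * G2 x \<le> r x * indicator F x"
    proof cases
      case 1
      moreover have "0 \<le> a1 * G1 x" "0 \<le> a2 * G2 x" unfolding G1 G2 using rpos[of x] by simp_all
      ultimately show ?thesis by simp
    next
      case 2
      then have "1 \<le> (r x / exp l) powr (\<delta> / 2)" using \<delta> by (intro ge_one_powr_ge_zero) auto
      then have "r x * 1 \<le> a1 * G1 x" unfolding G1 using rpos[of x] by (intro mult_left_mono) auto
      moreover have "0 \<le> a2 * G2 x" unfolding G2 using rpos[of x] by simp
      moreover have "0 \<le> r x * indicator F x" using rpos[of x] by simp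
      ultimately show ?thesis by linarith
    next
      case 3
      then have "0 \<le> \<delta> * \<theta> * (\<theta> * N / 2 - \<delta> * \<psi> - Y x)" using \<delta> \<theta> by simp
      then have "1 \<le> exp (\<delta> * \<theta> * (\<theta> * N / 2 - \<delta> * \<psi> - Y x))" by simp
      then have "r x * 1 \<le> a2 * G2 x" unfolding G2 using rpos[of x] by (intro mult_left_mono) auto
      moreover have "0 \<le> a1 * G1 x" unfolding G1 using rpos[of x] by simp
      moreover have "0 \<le> r x * indicator F x" using rpos[of x] by simp
      ultimately show ?thesis by linarith
    qed
  qed (intro Bochner_Integration.integrable_diff integrable_mult_right int_r int1 int2 int_F)+
  moreover have "unit_M.expectation (\<lambda>x. r x - a1 * G1 x - a2 * G2 x)
      = 1 - a1 * unit_M.expectation G1 - a2 * unit_M.expectation G2"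
    using int_r int1 int2 expectation_R[OF pL A(1), of \<theta>] by (simp add: r_def)
  moreover have "a1 * unit_M.expectation G1 \<le> w"
  proof -
    have "a1 * unit_M.expectation G1
      \<le> a1 * exp (((e1 + 0)\<^sup>2 - e1) / 4 * \<theta>\<^sup>2 * N + 400 * \<bar>\<theta>\<bar> ^ 3 * (real L)\<^sup>2 * N)"
      using E1 by (intro mult_left_mono) (auto simp: a1_def)
    also have "\<dots> = exp (- (\<delta> / 2 * l) + (((e1 + 0)\<^sup>2 - e1) / 4 * \<theta>\<^sup>2 * N + 400 * \<bar>\<theta>\<bar> ^ 3 * (real L)\<^sup>2 * N))"
      by (simp only: a1_def exp_add)
    also have "\<dots> \<le> w"
      unfolding w_def exp_le_cancel_iff
    proof -
      have "((e1 + 0)\<^sup>2 - e1) / 4 * \<theta>\<^sup>2 * N = (\<delta> / 2 * (1 + \<delta> / 2) / 4) * (\<theta>\<^sup>2 * N)"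
        by (simp add: e1_def power2_eq_square algebra_simps)
      also have "\<dots> \<le> (\<delta> / 2 * (1 + \<delta> / 2) / 4) * (4 * (1 - \<delta>)\<^sup>2 * l)"
        using \<delta> by (intro mult_left_mono \<theta>N) auto
      also have "\<dots> = \<delta> / 2 * l * ((1 + \<delta> / 2) * (1 - \<delta>)\<^sup>2)" by simp
      also have "\<dots> \<le> \<delta> / 2 * l * (1 - \<delta>)"
      proof (rule mult_left_mono)
        have "(1 + \<delta> / 2) * (1 - \<delta>) = 1 - \<delta> / 2 - \<delta>\<^sup>2 / 2"
          by (simp add: power2_eq_square field_simps)
        also have "\<dots> \<le> 1" using \<delta> zero_le_power2[of \<delta>] by linarith
        finally have "(1 + \<delta> / 2) * (1 - \<delta>) * (1 - \<delta>) \<le> 1 * (1 - \<delta>)"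
          using \<delta> by (intro mult_right_mono) auto
        then show "(1 + \<delta> / 2) * (1 - \<delta>)\<^sup>2 \<le> 1 - \<delta>" by (simp add: power2_eq_square mult.assoc)
      qed (use \<delta> l in simp)
      also have "\<dots> = \<delta> / 2 * l - \<delta>\<^sup>2 / 2 * l"
        unfolding right_diff_distrib by (simp add: power2_eq_square)
      finally show "- (\<delta> / 2 * l) + (((e1 + 0)\<^sup>2 - e1) / 4 * \<theta>\<^sup>2 * N + 400 * \<bar>\<theta>\<bar> ^ 3 * (real L)\<^sup>2 * N)
        \<le> - \<delta>\<^sup>2 / 4 * l" using err by linarith
    qed
    finally show ?thesis .
  qed
  moreover have "a2 * unit_M.expectation G2 \<le> w"
  proof -
    have "a2 * unit_M.expectation G2
      \<le> a2 * exp (((1 + - \<delta>)\<^sup>2 - 1) / 4 * \<theta>\<^sup>2 * N + 400 * \<bar>\<theta>\<bar> ^ 3 * (real L)\<^sup>2 * N)"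
      using E2 by (intro mult_left_mono) (auto simp: a2_def)
    also have "\<dots> = exp (\<delta> * \<theta> * (\<theta> * N / 2 - \<delta> * \<psi>) + (((1 + - \<delta>)\<^sup>2 - 1) / 4 * \<theta>\<^sup>2 * N + 400 * \<bar>\<theta>\<bar> ^ 3 * (real L)\<^sup>2 * N))"
      by (simp only: a2_def exp_add)
    also have "\<dots> \<le> w"
      unfolding w_def exp_le_cancel_iff
    proof -
      \<comment> \<open>The terms linear in \<delta> cancel, because the threshold is centred at the
        tilted mean \<theta> * N / 2.\<close>
      have "\<delta> * \<theta> * (\<theta> * N / 2 - \<delta> * \<psi>) + ((1 + - \<delta>)\<^sup>2 - 1) / 4 * \<theta>\<^sup>2 * N
        = \<delta>\<^sup>2 / 4 * (\<theta>\<^sup>2 * N) - \<delta>\<^sup>2 * (\<theta> * \<psi>)"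
      proof -
        have c: "((1 + - \<delta>)\<^sup>2 - 1) / 4 = \<delta>\<^sup>2 / 4 - \<delta> / 2"
        proof -
          have "(1 + - \<delta>)\<^sup>2 = 1 - 2 * \<delta> + \<delta>\<^sup>2" by (simp add: power2_eq_square algebra_simps)
          then show ?thesis by simp
        qed
        show ?thesis unfolding c by (simp add: power2_eq_square algebra_simps)
      qed
      also have "\<dots> \<le> \<delta>\<^sup>2 / 4 * (4 * (1 - \<delta>)\<^sup>2 * l) - \<delta>\<^sup>2 * (2 * (1 - \<delta>) * l)"
        unfolding \<psi> using \<theta>N by (intro diff_right_mono mult_left_mono) auto
      also have "\<dots> = - (\<delta>\<^sup>2 * l * (1 - \<delta>\<^sup>2))" by (simp add: power2_eq_square algebra_simps)
      also have "\<dots> \<le> - (\<delta>\<^sup>2 * l * (1 / 2))"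
        using \<delta>2 l by (intro le_imp_neg_le mult_left_mono) auto
      finally show "\<delta> * \<theta> * (\<theta> * N / 2 - \<delta> * \<psi>) + (((1 + - \<delta>)\<^sup>2 - 1) / 4 * \<theta>\<^sup>2 * N + 400 * \<bar>\<theta>\<bar> ^ 3 * (real L)\<^sup>2 * N)
        \<le> - \<delta>\<^sup>2 / 4 * l" using err by linarith
    qed
    finally show ?thesis .
  qed
  ultimately have "1 - 2 * w \<le> unit_M.expectation (\<lambda>x. r x * indicator F x)" by linarith
  then show ?thesis by (simp add: w_def r_def F_def Y_def N_def)
qed

text \<open>The stretch from b^k to b^(k + 1) dominates the partial sum up to its end. Besides the
  extremal event for its blocks, it remains to see that its gaps and everything before it are
  negligible, which is \<open>small\<close>.\<close>

theorem T_lower: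
  fixes \<rho> :: "nat \<Rightarrow> nat"
  assumes \<rho>: "inj \<rho>" and \<epsilon>: "0 < \<epsilon>" "\<epsilon> < 1"
  shows "AE x in unit_M. \<exists>\<^sub>F N in sequentially. (1 - \<epsilon>) * \<phi> N \<le> T (\<rho> ` {..<N}) x"
proof -
  define \<delta> where "\<delta> = \<epsilon> / 8"
  have \<delta>: "0 < \<delta>" "\<delta> \<le> 1 / 8" using \<epsilon> by (auto simp: \<delta>_def)
  have D0: "104 \<le> D" by (rule D_ge)
  \<comment> \<open>For at most w * n k indices and threshold \<delta> * \<psi> k, the crude
    exponent is exactly 2 * ln k, giving summable probabilities k^(- 2).\<close>
  define w where "w = \<delta>\<^sup>2 / (2 * D)"
  have w0: "0 < w" using \<delta> D0 by (simp add: w_def)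
  have w\<delta>: "w \<le> \<delta>"
  proof -
    have "\<delta>\<^sup>2 \<le> 1 * \<delta>" unfolding power2_eq_square using \<delta> by (intro mult_right_mono) auto
    also have "\<dots> \<le> 2 * D * \<delta>" using \<delta> D0 by (intro mult_right_mono) auto
    finally show ?thesis using D0 by (simp add: w_def divide_le_eq mult.commute)
  qed
  define L where "L = nat \<lceil>real s / w\<rceil> + s + 1"
  have L: "s < L" "real s / w \<le> real L" unfolding L_def by linarith+
  have L0: "0 < real L" using L by simp
  have sL: "real s / real L \<le> w" using L w0 L0 by (simp add: field_simps)
  \<comment> \<open>b - 1 \<ge> 1 / w makes the first b^k indices at most w * n k many; b \<ge> 1 /
    \<delta> makes n k at least (1 - \<delta>) * b^(k + 1).\<close>
  define b where "b = nat \<lceil>1 / w\<rceil> + nat \<lceil>1 / \<delta>\<rceil> + 2"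
  have b: "2 \<le> b" "1 / w \<le> real b - 1" "1 / \<delta> \<le> real b" unfolding b_def by linarith+
  have b2: "2 \<le> real b" using b by simp
  define n where "n = (\<lambda>k::nat. (real b - 1) * real b ^ k)"
  \<comment> \<open>ln k replaces ln (ln (b^(k + 1))), to which it is asymptotic, so that the
    truncation height exp (l k) is k.\<close>
  define l where "l = (\<lambda>k::nat. ln (real k))"
  define \<psi> where "\<psi> = (\<lambda>k. sqrt (n k * l k))"
  define \<theta> where "\<theta> = (\<lambda>k. 2 * (1 - \<delta>) * sqrt (l k / n k))"
  define A where "A = (\<lambda>k. \<rho> ` {b ^ k..<b ^ (k + 1)})"
  have n0: "0 < n k" for k using b2 by (simp add: n_def)
  have n2: "2 ^ k \<le> n k" for k
  proof -
    have "1 * 2 ^ k \<le> (real b - 1) * real b ^ k" using b2 by (intro mult_mono power_mono) auto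
    then show ?thesis by (simp add: n_def)
  qed
  have finA: "finite (A k)" for k by (simp add: A_def)
  have cardA: "real (card (A k)) = n k" for k
  proof -
    have "card (A k) = b ^ (k + 1) - b ^ k"
      unfolding A_def using \<rho> by (simp add: card_image inj_on_subset)
    moreover have "b ^ k \<le> b ^ (k + 1)" using b by (intro power_increasing) auto
    ultimately show ?thesis by (simp add: n_def of_nat_diff algebra_simps)
  qed
  have disj: "A i \<inter> A j = {}" if "i \<noteq> j" for i j
  proof -
    have *: "A i \<inter> A j = {}" if "i < j" for i j
    proof -
      have "b ^ (i + 1) \<le> b ^ j" using that b by (intro power_increasing) auto
      then have "{b ^ i..<b ^ (i + 1)} \<inter> {b ^ j..<b ^ (j + 1)} = {}" by auto
      then show ?thesis unfolding A_def using \<rho> by (simp add: image_Int[symmetric])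
    qed
    show ?thesis using *[of i j] *[of j i] that by (cases i j rule: linorder_cases) auto
  qed
  have "\<forall>\<^sub>F k in sequentially. 2 \<le> k \<and> 6400 * \<theta> k * (real L)\<^sup>2 \<le> \<delta>\<^sup>2
      \<and> (1 - \<delta>) * ln (real (k + 1) * ln (real b)) \<le> l k"
  proof (intro eventually_conj)
    show "\<forall>\<^sub>F k in sequentially. 2 \<le> (k::nat)" by (rule eventually_ge_at_top)
    have "(\<lambda>k::nat. (12800 * (real L)\<^sup>2) * sqrt (ln (real k) / 2 ^ k)) \<longlonglongrightarrow> (12800 * (real L)\<^sup>2) * 0"
      by (rule tendsto_mult_left) real_asymp
    then have "\<forall>\<^sub>F k in sequentially. (12800 * (real L)\<^sup>2) * sqrt (ln (real k) / 2 ^ k) < \<delta>\<^sup>2"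
      using \<delta> by (intro order_tendstoD(2)) auto
    then show "\<forall>\<^sub>F k in sequentially. 6400 * \<theta> k * (real L)\<^sup>2 \<le> \<delta>\<^sup>2"
      using eventually_ge_at_top[of 2]
    proof eventually_elim
      case (elim k)
      have "l k / n k \<le> ln (real k) / 2 ^ k"
        unfolding l_def using elim n2[of k] by (intro divide_left_mono) (auto simp: n0)
      then have "sqrt (l k / n k) \<le> sqrt (ln (real k) / 2 ^ k)" by simp
      moreover have "0 \<le> sqrt (l k / n k)" using n0[of k] elim by (simp add: l_def)
      ultimately have "\<theta> k \<le> 2 * sqrt (ln (real k) / 2 ^ k)"
        unfolding \<theta>_def using \<delta> by (intro mult_mono) auto
      then have "6400 * \<theta> k * (real L)\<^sup>2 \<le> 6400 * (2 * sqrt (ln (real k) / 2 ^ k)) * (real L)\<^sup>2"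
        by (intro mult_right_mono mult_left_mono) auto
      then show ?case using elim by (simp add: mult_ac)
    qed
    define c where "c = ln (ln (real b))"
    have lnb: "0 < ln (real b)" using b2 by simp
    have "(\<lambda>k::nat. (ln (real k + 1) + c) / ln (real k)) \<longlonglongrightarrow> 1" by real_asymp
    then have "\<forall>\<^sub>F k::nat in sequentially. (ln (real k + 1) + c) / ln (real k) < 1 / (1 - \<delta>)"
      using \<delta> by (intro order_tendstoD(2)) (auto simp: field_simps)
    then show "\<forall>\<^sub>F k in sequentially. (1 - \<delta>) * ln (real (k + 1) * ln (real b)) \<le> l k"
      using eventually_ge_at_top[of 2]
    proof eventually_elim
      case (elim k)
      have "ln (real (k + 1) * ln (real b)) = ln (real k + 1) + c"
        using lnb by (simp add: ln_mult c_def add.commute)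
      moreover have "0 < ln (real k)" using elim by simp
      then have "(1 - \<delta>) * (ln (real k + 1) + c) \<le> ln (real k)"
        using elim(1) \<delta> by (simp add: field_simps)
      ultimately show ?case by (simp add: l_def)
    qed
  qed
  then obtain k0 where k0: "\<And>k. k0 \<le> k \<Longrightarrow> 2 \<le> k \<and> 6400 * \<theta> k * (real L)\<^sup>2 \<le> \<delta>\<^sup>2
      \<and> (1 - \<delta>) * ln (real (k + 1) * ln (real b)) \<le> l k"
    unfolding eventually_sequentially by blast
  have l0: "0 < l k" if "2 \<le> k" for k using that by (simp add: l_def)
  have \<theta>0: "0 < \<theta> k" if "2 \<le> k" for k using l0[OF that] n0[of k] \<delta> by (simp add: \<theta>_def)
  have \<theta>n: "\<theta> k * n k = 2 * (1 - \<delta>) * \<psi> k" and \<theta>2n: "(\<theta> k)\<^sup>2 * n k = 4 * (1 - \<delta>)\<^sup>2 * l k"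
    and \<theta>\<psi>: "\<theta> k * \<psi> k = 2 * (1 - \<delta>) * l k" if "2 \<le> k" for k
  proof -
    define u v where "u = sqrt (l k)" and "v = sqrt (n k)"
    have uv: "0 < u" "0 < v" "l k = u\<^sup>2" "n k = v\<^sup>2" using l0[OF that] n0[of k] by (auto simp: u_def v_def)
    have \<theta>: "\<theta> k = 2 * (1 - \<delta>) * (u / v)" by (simp add: \<theta>_def u_def v_def real_sqrt_divide)
    have \<psi>: "\<psi> k = u * v" by (simp add: \<psi>_def u_def v_def real_sqrt_mult)
    show "\<theta> k * n k = 2 * (1 - \<delta>) * \<psi> k" unfolding \<theta> \<psi> uv(4) using uv by (simp add: power2_eq_square)
    show "(\<theta> k)\<^sup>2 * n k = 4 * (1 - \<delta>)\<^sup>2 * l k"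
      unfolding \<theta> uv(3,4) power_mult_distrib power_divide using uv by simp
    show "\<theta> k * \<psi> k = 2 * (1 - \<delta>) * l k" unfolding \<theta> \<psi> uv(3) using uv by (simp add: power2_eq_square)
  qed
  have small: "AE x in unit_M. \<forall>\<^sub>F k in sequentially. \<bar>T (C k) x\<bar> < \<delta> * \<psi> k"
    if C: "\<And>k. finite (C k)" "\<And>k. real (card (C k)) \<le> w * n k" for C
  proof -
    define B where "B = (\<lambda>k. {x \<in> space unit_M. \<delta> * \<psi> k \<le> \<bar>T (C k) x\<bar>})"
    have B_sets: "B k \<in> sets unit_M" for k unfolding B_def by (rule T_abs_sets)
    have B_le: "unit_M.prob (B k) \<le> D * inverse (real k ^ 2)" if k: "2 \<le> k" for k
    proof -
      have \<psi>0: "0 < \<psi> k" using l0[OF k] n0[of k] by (simp add: \<psi>_def)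
      have "unit_M.prob (B k) \<le> D * exp (- (\<delta> * \<psi> k)\<^sup>2 / (D * (w * n k)))"
        unfolding B_def using C w0 n0[of k] \<delta> \<psi>0 by (intro T_tail_crude) auto
      also have "- (\<delta> * \<psi> k)\<^sup>2 / (D * (w * n k)) = - (2 * l k)"
      proof -
        have "(\<psi> k)\<^sup>2 = n k * l k" using l0[OF k] n0[of k] by (simp add: \<psi>_def)
        moreover have "D * (w * n k) = \<delta>\<^sup>2 * n k / 2" using D0 by (simp add: w_def)
        ultimately have "- (\<delta> * \<psi> k)\<^sup>2 / (D * (w * n k)) = - (\<delta>\<^sup>2 * (n k * l k)) / (\<delta>\<^sup>2 * n k / 2)"
          by (simp only: power_mult_distrib)
        also have "\<dots> = - (2 * l k)" using \<delta> n0[of k] by simp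
        finally show ?thesis .
      qed
      also have "exp (- (2 * l k)) = inverse (real k ^ 2)"
        using k by (simp add: exp_minus l_def exp_of_nat_mult[of 2, simplified])
      finally show ?thesis .
    qed
    have "summable (\<lambda>k. unit_M.prob (B k))"
    proof (rule summable_comparison_test_ev)
      show "\<forall>\<^sub>F k in sequentially. norm (unit_M.prob (B k)) \<le> D * inverse (real k ^ 2)"
        using eventually_ge_at_top[of 2] by eventually_elim (use B_le in simp)
      show "summable (\<lambda>k. D * inverse (real k ^ 2))"
        by (intro summable_mult inverse_power_summable) simp
    qed
    then have "AE x in unit_M. \<forall>\<^sub>F k in sequentially. x \<in> space unit_M - B k"
      using B_sets by (intro borel_cantelli_AE1) (auto simp: unit_M.emeasure_eq_measure)
    then show ?thesis
      by eventually_elim (auto simp: B_def not_le elim!: eventually_mono)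
  qed
  have "\<exists>p<L. real (card (A k - big L p (A k))) \<le> w * n k" for k
  proof -
    obtain p where p: "p < L" "real (card (A k - big L p (A k))) \<le> real s / real L * real (card (A k))"
      using exists_phase[OF L(1) finA[of k]] by blast
    have "real s / real L * real (card (A k)) \<le> w * n k"
      unfolding cardA using sL n0[of k] by (intro mult_right_mono) auto
    then show ?thesis using p by fastforce
  qed
  then obtain pf where pf: "\<And>k. pf k < L" "\<And>k. real (card (A k - big L (pf k) (A k))) \<le> w * n k"
    by metis
  \<comment> \<open>The phase that suits stretch k depends on k. The harmonic series splits into L
    subseries by phase, and one of them must diverge; only its stretches are used.\<close>
  obtain p where p: "p < L" and diverges: "\<not> summable (\<lambda>k. if k0 \<le> k \<and> pf k = p then 1 / real k else 0)"
  proof (rule ccontr)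
    assume "\<not> thesis"
    then have "summable (\<lambda>k. if k0 \<le> k \<and> pf k = p then 1 / real k else 0)" if "p < L" for p
      using that \<open>\<And>p. p < L \<Longrightarrow> \<not> summable (\<lambda>k. if k0 \<le> k \<and> pf k = p then 1 / real k else 0) \<Longrightarrow> thesis\<close> by blast
    then have "summable (\<lambda>k. \<Sum>p<L. if k0 \<le> k \<and> pf k = p then 1 / real k else 0)"
      by (intro summable_sum) auto
    moreover have "(\<Sum>p<L. if k0 \<le> k \<and> pf k = p then 1 / real k else 0) = (if k0 \<le> k then 1 / real k else 0)" for k
      using pf(1)[of k] by (cases "k0 \<le> k") (auto simp: sum.delta')
    ultimately have sm: "summable (\<lambda>k. if k0 \<le> k then 1 / real k else 0)" by simp
    have "\<forall>\<^sub>F k in sequentially. (if k0 \<le> k then 1 / real k else 0) = 1 / real k"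
      using eventually_ge_at_top[of k0] by eventually_elim simp
    from summable_cong[OF this] sm have "summable (\<lambda>k. 1 / real k)" by (rule iffD1)
    then show False using not_summable_harmonic[where 'a = real] by (simp add: divide_inverse)
  qed
  define W where "W = {k. k0 \<le> k \<and> pf k = p}"
  define c where "c = (\<lambda>k. if k \<in> W then 1 / real k else 0)"
  define F where "F = (\<lambda>k. {x. R L p (\<theta> k) (A k) x \<le> exp (l k) \<and>
      \<theta> k * card (big L p (A k)) / 2 - \<delta> * \<psi> k \<le> T (big L p (A k)) x})"
  define f where "f = (\<lambda>k x. R L p (\<theta> k) (A k) x * indicator (F k) x)"
  \<comment> \<open>The truncated Riesz product is at most k with mean near 1, so the weight 1 / k
    puts h into the unit interval with mean near c k.\<close>
  define h where "h = (\<lambda>k x. c k * f k x)"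
  have W: "2 \<le> k" "6400 * \<theta> k * (real L)\<^sup>2 \<le> \<delta>\<^sup>2" "0 < \<theta> k" if "k \<in> W" for k
    using that k0[of k] \<theta>0[of k] by (auto simp: W_def)
  have R0: "0 < R L p (\<theta> k) (A k) x" if "k \<in> W" for k x
  proof -
    have "real L \<le> (real L)\<^sup>2" using L0 L by (simp add: power2_eq_square)
    then have "\<theta> k * real L \<le> \<theta> k * (real L)\<^sup>2" using W(3)[OF that] by (intro mult_left_mono) auto
    moreover have "\<delta>\<^sup>2 \<le> 1 * 1" unfolding power2_eq_square using \<delta> by (intro mult_mono) auto
    ultimately have "\<theta> k * real L \<le> 1 / 16" using W(2)[OF that] by linarith
    then show ?thesis using W(3)[OF that] by (intro R_pos[OF p L(1)]) auto
  qed
  have int_R: "integrable unit_M (R L p (\<theta> k) (A k))" for k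
    by (intro integrable_unit_M R_continuous)
  have int_RR: "integrable unit_M (\<lambda>x. R L p (\<theta> k) (A k) x * R L p (\<theta> j) (A j) x)" for k j
    by (intro integrable_unit_M continuous_intros R_continuous)
  have f_meas: "f k \<in> borel_measurable unit_M" for k
    unfolding f_def F_def by (rule R_truncated_measurable)
  have f0: "0 \<le> f k x" and f_le: "f k x \<le> R L p (\<theta> k) (A k) x" if "k \<in> W" for k x
    using R0[OF that, of x] by (auto simp: f_def indicator_def)
  have f_exp: "f k x \<le> real k" if "k \<in> W" for k x
    using W(1)[OF that] by (auto simp: f_def F_def indicator_def l_def)
  have int_f: "integrable unit_M (f k)" if "k \<in> W" for k
    by (rule Bochner_Integration.integrable_bound[OF int_R[of k] f_meas])
      (rule AE_I2, use f0[OF that] f_le[OF that] R0[OF that] in \<open>simp add: abs_of_pos\<close>)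
  have Ef: "unit_M.expectation (f k) \<le> 1" if "k \<in> W" for k
    using integral_mono[OF int_f[OF that] int_R[of k] f_le[OF that]] expectation_R[OF p L(1) finA]
    by simp
  have "AE x in unit_M. \<exists>\<^sub>F k in sequentially. 0 < h k x"
  proof (rule unit_M.weighted_borel_cantelli)
    show "h k \<in> borel_measurable unit_M" for k
      unfolding h_def using f_meas by (intro borel_measurable_times) auto
    show "0 \<le> h k x" for k x using f0[of k x] by (simp add: h_def c_def)
    show "h k x \<le> 1" for k x
      using f_exp[of k x] W(1)[of k] by (cases "k \<in> W") (simp_all add: h_def c_def divide_le_eq)
    show "unit_M.expectation (h k) \<le> c k" for k
      using Ef[of k] W(1)[of k] by (cases "k \<in> W") (simp_all add: h_def c_def divide_right_mono)
    show "unit_M.expectation (\<lambda>x. h k x * h j x) \<le> c k * c j" if "k \<noteq> j" for k j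
    proof (cases "k \<in> W \<and> j \<in> W")
      case True
      have le: "f k x * f j x \<le> R L p (\<theta> k) (A k) x * R L p (\<theta> j) (A j) x" for x
        using True f0 f_le R0 by (intro mult_mono) (auto intro: less_imp_le)
      have "integrable unit_M (\<lambda>x. f k x * f j x)"
        by (rule Bochner_Integration.integrable_bound[OF int_RR[of k j] borel_measurable_times[OF f_meas f_meas]])
          (rule AE_I2, use True le f0 R0 in \<open>simp add: abs_mult abs_of_pos abs_of_nonneg\<close>)
      then have "unit_M.expectation (\<lambda>x. f k x * f j x) \<le> 1"
        using integral_mono[OF _ int_RR le] expectation_R_mult_R[OF p L(1) finA finA disj[OF that]] by simp
      then have "(c k * c j) * unit_M.expectation (\<lambda>x. f k x * f j x) \<le> (c k * c j) * 1"
        by (intro mult_left_mono) (auto simp: c_def)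
      moreover have "h k x * h j x = (c k * c j) * (f k x * f j x)" for x by (simp add: h_def)
      ultimately show ?thesis by simp
    next
      case False
      then show ?thesis by (auto simp: h_def c_def)
    qed
    show "\<forall>\<^sub>F k in sequentially. (1 - \<eta>) * c k \<le> unit_M.expectation (h k)" if "0 < \<eta>" for \<eta>
    proof -
      have "(\<lambda>k::nat. 2 * exp (- \<delta>\<^sup>2 / 4 * ln (real k))) \<longlonglongrightarrow> 0"
        using \<delta> by real_asymp
      then have "\<forall>\<^sub>F k in sequentially. 2 * exp (- \<delta>\<^sup>2 / 4 * ln (real k)) < \<eta>"
        using that by (intro order_tendstoD(2)) auto
      then show ?thesis
      proof eventually_elim
        case (elim k)
        show ?case
        proof (cases "k \<in> W")
          case True
          have "1 - 2 * exp (- \<delta>\<^sup>2 / 4 * l k) \<le> unit_M.expectation (f k)"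
            unfolding f_def F_def
            using expectation_R_truncated[OF p L(1) finA _ W(3)[OF True] W(2)[OF True] \<delta>(1) _ _
              \<theta>2n[OF W(1)[OF True]] \<theta>\<psi>[OF W(1)[OF True]]] cardA[of k] l0[OF W(1)[OF True]] \<delta>
            by simp
          then have "1 - \<eta> \<le> unit_M.expectation (f k)" using elim by (simp add: l_def)
          then have "c k * (1 - \<eta>) \<le> c k * unit_M.expectation (f k)"
            by (intro mult_left_mono) (auto simp: c_def)
          then show ?thesis by (simp add: h_def mult.commute)
        qed (simp add: h_def c_def)
      qed
    qed
    show "\<not> summable c" using diverges by (simp add: c_def W_def)
  qed
  moreover have "AE x in unit_M. \<forall>\<^sub>F k in sequentially. \<bar>T (A k - big L (pf k) (A k)) x\<bar> < \<delta> * \<psi> k"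
    using pf(2) finA by (intro small) auto
  moreover have "AE x in unit_M. \<forall>\<^sub>F k in sequentially. \<bar>T (\<rho> ` {..<b ^ k}) x\<bar> < \<delta> * \<psi> k"
  proof (rule small)
    fix k
    show "finite (\<rho> ` {..<b ^ k})" by simp
    have "real (card (\<rho> ` {..<b ^ k})) \<le> real (b ^ k)" using card_image_le[of "{..<b ^ k}" \<rho>] by simp
    also have "\<dots> = 1 * real b ^ k" by simp
    also have "\<dots> \<le> (w * (real b - 1)) * real b ^ k"
      using b(2) w0 by (intro mult_right_mono) (auto simp: field_simps)
    finally show "real (card (\<rho> ` {..<b ^ k})) \<le> w * n k" by (simp add: n_def mult.assoc)
  qed
  ultimately show ?thesis
  proof eventually_elim
    case (elim x)
    have "\<exists>\<^sub>F k in sequentially. (1 - \<epsilon>) * \<phi> (b ^ (k + 1)) \<le> T (\<rho> ` {..<b ^ (k + 1)}) x"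
      using frequently_eventually_frequently[OF elim(1) eventually_conj[OF elim(2,3)]]
    proof (rule frequently_elim1)
      fix k assume k: "0 < h k x \<and> \<bar>T (A k - big L (pf k) (A k)) x\<bar> < \<delta> * \<psi> k
        \<and> \<bar>T (\<rho> ` {..<b ^ k}) x\<bar> < \<delta> * \<psi> k"
      then have "c k \<noteq> 0" and "indicator (F k) x \<noteq> (0 :: real)" by (auto simp: h_def f_def)
      then have kW: "k \<in> W" and xF: "x \<in> F k"
        by (simp_all add: c_def indicator_eq_0_iff split: if_splits)
      have k2: "2 \<le> k" using W(1)[OF kW] .
      define X where "X = big L p (A k)"
      have pfk: "pf k = p" using kW by (simp add: W_def)
      have \<psi>0: "0 \<le> \<psi> k" using l0[OF k2] n0[of k] by (simp add: \<psi>_def)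
      have X: "X \<subseteq> A k" "finite X" using big_subset finite_big[OF finA] by (auto simp: X_def)
      have "card (A k) = card X + card (A k - X)"
        using X finA[of k] card_mono[of "A k" X] by (simp add: card_Diff_subset)
      then have "n k = real (card X) + real (card (A k - X))" using cardA[of k] by simp
      moreover have "real (card (A k - X)) \<le> \<delta> * n k"
      proof -
        have "w * n k \<le> \<delta> * n k" using n0[of k] by (intro mult_right_mono w\<delta>) simp
        then show ?thesis using pf(2)[of k] unfolding pfk X_def by linarith
      qed
      ultimately have "(1 - \<delta>) * n k \<le> real (card X)" by (simp add: algebra_simps)
      then have "\<theta> k * ((1 - \<delta>) * n k) \<le> \<theta> k * real (card X)"
        using \<theta>0[OF k2] by (intro mult_left_mono) auto
      moreover have "\<theta> k * ((1 - \<delta>) * n k) = 2 * ((1 - \<delta>)\<^sup>2 * \<psi> k)"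
        using \<theta>n[OF k2] by (simp add: power2_eq_square mult_ac)
      moreover have "\<theta> k * real (card X) / 2 - \<delta> * \<psi> k \<le> T X x" using xF by (simp add: F_def X_def)
      ultimately have TX: "(1 - \<delta>)\<^sup>2 * \<psi> k - \<delta> * \<psi> k \<le> T X x" by linarith
      have "T (\<rho> ` {..<b ^ (k + 1)}) x - T (\<rho> ` {..<b ^ k}) x = T (A k) x"
        unfolding A_def using b by (intro T_image_diff \<rho> power_increasing) auto
      moreover have "T (A k) x = T X x + T (A k - X) x"
        using T_union[of X "A k - X" x] X finA[of k] by (simp add: Un_absorb1)
      \<comment> \<open>One \<delta> * \<psi> k each for the deviation allowed in F, the gaps of the
        stretch and the indices before it.\<close>
      ultimately have "(1 - \<delta>)\<^sup>2 * \<psi> k - 3 * (\<delta> * \<psi> k) \<le> T (\<rho> ` {..<b ^ (k + 1)}) x"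
        using TX k[THEN conjunct2, unfolded pfk X_def[symmetric]] by linarith
      moreover have "(1 - 5 * \<delta>) * \<psi> k + \<delta>\<^sup>2 * \<psi> k = (1 - \<delta>)\<^sup>2 * \<psi> k - 3 * (\<delta> * \<psi> k)"
        by (simp add: power2_eq_square algebra_simps)
      moreover have "0 \<le> \<delta>\<^sup>2 * \<psi> k" using \<psi>0 by simp
      ultimately have S: "(1 - 5 * \<delta>) * \<psi> k \<le> T (\<rho> ` {..<b ^ (k + 1)}) x" by linarith
      have \<phi>\<psi>: "(1 - \<delta>) * \<phi> (b ^ (k + 1)) \<le> \<psi> k"
      proof -
        define g where "g = ln (real (k + 1) * ln (real b))"
        define m where "m = real b ^ (k + 1)"
        have m0: "0 < m" using b2 by (simp add: m_def)
        have "ln (ln (real (b ^ (k + 1)))) = g" 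
          using b2 ln_realpow[of "real b" "k + 1"] unfolding g_def of_nat_power by simp
        then have \<phi>: "\<phi> (b ^ (k + 1)) = sqrt (m * g)" by (simp add: \<phi>_def m_def)
        have "n k = (1 - 1 / real b) * m" using b2 by (simp add: n_def m_def field_simps)
        moreover have "1 - \<delta> \<le> 1 - 1 / real b" using b(3) \<delta> b2 by (simp add: field_simps)
        ultimately have "(1 - \<delta>) * m \<le> n k" using m0 mult_right_mono[of "1 - \<delta>" "1 - 1 / real b" m] by simp
        moreover have "(1 - \<delta>) * g \<le> l k" using k0[of k] kW by (simp add: W_def g_def)
        ultimately have "((1 - \<delta>) * m) * ((1 - \<delta>) * g) \<le> n k * l k"
        proof -
          assume 1: "(1 - \<delta>) * m \<le> n k" and 2: "(1 - \<delta>) * g \<le> l k"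
          have "((1 - \<delta>) * m) * ((1 - \<delta>) * g) \<le> ((1 - \<delta>) * m) * l k"
            using 2 \<delta> m0 by (intro mult_left_mono) auto
          also have "\<dots> \<le> n k * l k" using 1 l0[OF k2] by (intro mult_right_mono) auto
          finally show ?thesis .
        qed
        then have "(1 - \<delta>)\<^sup>2 * (m * g) \<le> n k * l k" by (simp add: power2_eq_square mult_ac)
        then have "sqrt ((1 - \<delta>)\<^sup>2 * (m * g)) \<le> \<psi> k" unfolding \<psi>_def by (rule real_sqrt_le_mono)
        then show ?thesis unfolding \<phi> using \<delta> by (simp add: real_sqrt_mult)
      qed
      show "(1 - \<epsilon>) * \<phi> (b ^ (k + 1)) \<le> T (\<rho> ` {..<b ^ (k + 1)}) x"
      proof (cases "0 \<le> \<phi> (b ^ (k + 1))")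
        case True
        have eq: "(1 - 5 * \<delta>) * (1 - \<delta>) = 1 - 6 * \<delta> + 5 * \<delta>\<^sup>2" by (simp add: power2_eq_square algebra_simps)
        have "\<epsilon> = 8 * \<delta>" by (simp add: \<delta>_def)
        then have "1 - \<epsilon> \<le> (1 - 5 * \<delta>) * (1 - \<delta>)"
          unfolding eq using \<delta>(1) zero_le_power2[of \<delta>] by linarith
        then have "(1 - \<epsilon>) * \<phi> (b ^ (k + 1)) \<le> (1 - 5 * \<delta>) * (1 - \<delta>) * \<phi> (b ^ (k + 1))"
          using True by (intro mult_right_mono) auto
        also have "\<dots> \<le> (1 - 5 * \<delta>) * \<psi> k"
          using \<phi>\<psi> \<delta> unfolding mult.assoc by (intro mult_left_mono) auto
        finally show ?thesis using S by linarith
      \<comment> \<open>Real \<open>sqrt\<close> is odd, so a negative iterated logarithm would make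
        \<phi> negative; the sign then settles the claim.\<close>
      next
        case False
        then have "(1 - \<epsilon>) * \<phi> (b ^ (k + 1)) \<le> 0" using \<epsilon> by (intro mult_nonneg_nonpos) auto
        moreover have "0 \<le> (1 - 5 * \<delta>) * \<psi> k" using \<psi>0 \<delta> by (intro mult_nonneg_nonneg) auto
        ultimately show ?thesis using S by linarith
      qed
    qed
    then show ?case
      unfolding frequently_sequentially
    proof (intro allI)
      fix m assume "\<forall>m. \<exists>k\<ge>m. (1 - \<epsilon>) * \<phi> (b ^ (k + 1)) \<le> T (\<rho> ` {..<b ^ (k + 1)}) x"
      then obtain k where k: "m \<le> k" "(1 - \<epsilon>) * \<phi> (b ^ (k + 1)) \<le> T (\<rho> ` {..<b ^ (k + 1)}) x" by blast
      have "k + 1 < 2 ^ (k + 1)" by (rule less_exp)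
      also have "(2::nat) ^ (k + 1) \<le> b ^ (k + 1)" using b by (intro power_mono) auto
      finally show "\<exists>N\<ge>m. (1 - \<epsilon>) * \<phi> N \<le> T (\<rho> ` {..<N}) x" using k by (intro exI[of _ "b ^ (k + 1)"]) auto
    qed
  qed
qed

end

section \<open>The law of the iterated logarithm\<close>

lemma limsup_ereal_eqI:
  fixes X :: "nat \<Rightarrow> real"
  assumes upper: "\<And>e. 0 < e \<Longrightarrow> \<forall>\<^sub>F n in sequentially. X n \<le> C + e"
    and lower: "\<And>e. 0 < e \<Longrightarrow> \<exists>\<^sub>F n in sequentially. C - e \<le> X n"
  shows "limsup (\<lambda>n. ereal (X n)) = ereal C"
proof (rule antisym)
  show "limsup (\<lambda>n. ereal (X n)) \<le> ereal C"
  proof (rule ereal_le_epsilon2)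
    fix e :: real assume "0 < e"
    then have "limsup (\<lambda>n. ereal (X n)) \<le> ereal (C + e)"
      using upper[of e] by (intro Limsup_bounded) simp
    then show "limsup (\<lambda>n. ereal (X n)) \<le> ereal C + ereal e" by simp
  qed
  show "ereal C \<le> limsup (\<lambda>n. ereal (X n))"
  proof (rule ereal_le_epsilon2)
    fix e :: real assume "0 < e"
    have "ereal (C - e) \<le> limsup (\<lambda>n. ereal (X n))"
    proof (rule ccontr)
      assume "\<not> ereal (C - e) \<le> limsup (\<lambda>n. ereal (X n))"
      then have "\<forall>\<^sub>F n in sequentially. ereal (X n) < ereal (C - e)"
        by (intro Limsup_lessD) (simp add: not_le)
      then have "\<forall>\<^sub>F n in sequentially. \<not> C - e \<le> X n" by (simp add: not_le)
      then show False using lower[OF \<open>0 < e\<close>] by (simp add: frequently_def)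
    qed
    then have "ereal (C - e) + ereal e \<le> limsup (\<lambda>n. ereal (X n)) + ereal e"
      by (rule add_right_mono)
    then show "ereal C \<le> limsup (\<lambda>n. ereal (X n)) + ereal e" by simp
  qed
qed

context lacunary
begin

text \<open>A sequence \<epsilon> m tending to 0 keeps the number of exceptional null sets
  countable.\<close>

theorem T_lil:
  fixes \<rho> :: "nat \<Rightarrow> nat"
  assumes \<rho>: "inj \<rho>"
  shows "AE x in unit_M. limsup (\<lambda>N. ereal (T (\<rho> ` {..<N}) x / sqrt (2 * real N * ln (ln (real N)))))
    = ereal (1 / sqrt 2)"
proof -
  define \<epsilon> where "\<epsilon> = (\<lambda>m::nat. 1 / real (m + 2))"
  have \<epsilon>: "0 < \<epsilon> m" "\<epsilon> m < 1" for m by (auto simp: \<epsilon>_def)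
  have "AE x in unit_M. (\<forall>m. \<forall>\<^sub>F N in sequentially. \<bar>T (\<rho> ` {..<N}) x\<bar> \<le> (1 + \<epsilon> m) * \<phi> N)
      \<and> (\<forall>m. \<exists>\<^sub>F N in sequentially. (1 - \<epsilon> m) * \<phi> N \<le> T (\<rho> ` {..<N}) x)"
    using T_upper[OF \<rho> \<epsilon>] T_lower[OF \<rho> \<epsilon>] by (simp add: AE_all_countable)
  then show ?thesis
  proof eventually_elim
    case (elim x)
    define X where "X = (\<lambda>N. T (\<rho> ` {..<N}) x / sqrt (2 * real N * ln (ln (real N))))"
    have X: "X N = T (\<rho> ` {..<N}) x / \<phi> N / sqrt 2" for N
      by (simp add: X_def \<phi>_def real_sqrt_mult mult.assoc)
    have pos: "\<forall>\<^sub>F N in sequentially. 0 < \<phi> N"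
      using eventually_lnln_ge[of 1] eventually_gt_at_top[of 0]
      by eventually_elim (simp add: \<phi>_def)
    have small: "\<exists>m. \<epsilon> m < e" if "0 < e" for e :: real
    proof -
      obtain m where "inverse (real (Suc m)) < e" using reals_Archimedean[OF \<open>0 < e\<close>] by blast
      moreover have "\<epsilon> m \<le> inverse (real (Suc m))" by (simp add: \<epsilon>_def divide_simps)
      ultimately have "\<epsilon> m < e" by linarith
      then show ?thesis ..
    qed
    have shrink: "e / sqrt 2 \<le> e" if "0 < e" for e :: real
      using that by (simp add: divide_le_eq)
    have "limsup (\<lambda>N. ereal (X N)) = ereal (1 / sqrt 2)"
    proof (rule limsup_ereal_eqI)
      fix e :: real assume e: "0 < e"
      obtain m where m: "\<epsilon> m < e" using small[OF e] by blast
      have e': "\<epsilon> m / sqrt 2 \<le> e" using shrink[OF \<epsilon>(1), of m] m by linarith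
      have "\<forall>\<^sub>F N in sequentially. \<bar>T (\<rho> ` {..<N}) x\<bar> \<le> (1 + \<epsilon> m) * \<phi> N" using elim by blast
      then show "\<forall>\<^sub>F N in sequentially. X N \<le> 1 / sqrt 2 + e"
        using pos
      proof eventually_elim
        case (elim N)
        then have "T (\<rho> ` {..<N}) x / \<phi> N \<le> 1 + \<epsilon> m" by (simp add: divide_le_eq)
        then have "X N \<le> (1 + \<epsilon> m) / sqrt 2" unfolding X by (intro divide_right_mono) auto
        then show ?case using e' by (simp add: add_divide_distrib)
      qed
      have "\<exists>\<^sub>F N in sequentially. (1 - \<epsilon> m) * \<phi> N \<le> T (\<rho> ` {..<N}) x" using elim by blast
      then have "\<exists>\<^sub>F N in sequentially. (1 - \<epsilon> m) * \<phi> N \<le> T (\<rho> ` {..<N}) x \<and> 0 < \<phi> N"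
        using pos by (rule frequently_eventually_frequently)
      then show "\<exists>\<^sub>F N in sequentially. 1 / sqrt 2 - e \<le> X N"
      proof (rule frequently_elim1)
        fix N assume "(1 - \<epsilon> m) * \<phi> N \<le> T (\<rho> ` {..<N}) x \<and> 0 < \<phi> N"
        then have "1 - \<epsilon> m \<le> T (\<rho> ` {..<N}) x / \<phi> N" by (simp add: le_divide_eq)
        then have "(1 - \<epsilon> m) / sqrt 2 \<le> X N" unfolding X by (intro divide_right_mono) auto
        then show "1 / sqrt 2 - e \<le> X N" using e' by (simp add: diff_divide_distrib)
      qed
    qed
    then show ?case by (simp add: X_def)
  qed
qed

end

theorem theorem3:
  fixes n :: "nat \<Rightarrow> nat" and \<sigma> :: "nat \<Rightarrow> nat" and q :: real
  assumes pos: "\<And>k. k \<ge> 1 \<Longrightarrow> n k > 0"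
    and q: "q > 1"
    and gap: "\<And>k. k \<ge> 1 \<Longrightarrow> real (n (Suc k)) / real (n k) \<ge> q"
    and perm: "bij_betw \<sigma> {1..} {1..}"
  shows "AE x in lborel. x \<in> {0<..<1} \<longrightarrow>
           limsup (\<lambda>N. ereal ((\<Sum>k=1..N. cos (2 * pi * real (n (\<sigma> k)) * x))
                         / sqrt (2 * real N * ln (ln (real N)))))
           = ereal (1 / sqrt 2)"
proof -
  have c: "0 < 1 - 1 / q" using q by simp
  obtain s where "5 / (1 - 1 / q) < q ^ s" using real_arch_pow[OF q] by blast
  then have s: "5 \<le> (1 - 1 / q) * q ^ s" 
    unfolding pos_divide_less_eq[OF c] by (simp only: mult.commute less_imp_le)
  \<comment> \<open>Shift to indices starting at 0. The subtraction in \<rho> does not truncate,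
    because \<sigma> maps into \<open>{1..}\<close>.\<close>
  define a where "a = (\<lambda>k. n (Suc k))"
  define \<rho> where "\<rho> = (\<lambda>k. \<sigma> (Suc k) - 1)"
  interpret lacunary a q s
  proof
    show "0 < a k" for k using pos by (simp add: a_def)
    then show "q * real (a k) \<le> real (a (Suc k))" for k
      using gap[of "Suc k"] by (simp add: a_def le_divide_eq)
  qed (fact q s)+
  have \<sigma>: "Suc (\<rho> k) = \<sigma> (Suc k)" for k
  proof -
    have "\<sigma> (Suc k) \<in> {1..}" using bij_betw_apply[OF perm, of "Suc k"] by simp
    then show ?thesis by (simp add: \<rho>_def)
  qed
  have inj: "inj \<rho>"
  proof (rule injI)
    fix i j assume "\<rho> i = \<rho> j"
    then have "\<sigma> (Suc i) = \<sigma> (Suc j)" by (simp flip: \<sigma>)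
    then show "i = j" using bij_betw_imp_inj_on[OF perm] by (auto dest: inj_onD)
  qed
  have S: "T (\<rho> ` {..<N}) x = (\<Sum>k=1..N. cos (2 * pi * real (n (\<sigma> k)) * x))" for N x
  proof -
    have "a (\<rho> k) = n (\<sigma> (Suc k))" for k by (simp add: a_def \<sigma>)
    moreover have "inj_on \<rho> {..<N}" using inj by (rule inj_on_subset) simp
    ultimately show ?thesis by (simp add: T_def sum.reindex sum.atLeast1_atMost_eq)
  qed
  have "AE x in lborel. x \<in> {0..1} \<longrightarrow>
           limsup (\<lambda>N. ereal (T (\<rho> ` {..<N}) x / sqrt (2 * real N * ln (ln (real N))))) = ereal (1 / sqrt 2)"
    using T_lil[OF inj] by (subst (asm) AE_restrict_space_iff) auto
  then show ?thesis
    unfolding S by eventually_elim auto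
qed

end
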